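(* Suppose that for every $i\in\{0,1,\dots,k+1\}$ the set $R_I^r(i)=\{\boldsymbol a\in C_{\boldsymbol a}\mid J_i(\boldsymbol a)=0\}$ has Lebesgue measure zero, that the valid set $R_I$ contains an interior point, and that the sum-of-squares programs $\mathbf{M}_d(i)$ are solvable (have an optimal solution) for all $d\in\mathbb{N}$ and all $i\in\{0,\dots,k+1\}$. For each $d$ and $i$ let $p_i^{(d)}(\boldsymbol a)=\sum_\alpha\mathrm{p}^i_\alpha\boldsymbol a^\alpha$ be the polynomial given by an optimal solution of $\mathbf{M}_d(i)$, and let $R^{(d)}=\bigcap_{i=0}^{k+1}\{\boldsymbol a\in C_{\boldsymbol a}\mid p_i^{(d)}(\boldsymbol a)\le 0\}$. Then there exists $d$ such that $R^{(d)}$ is a non-empty underapproximation of the valid set, i.e. $\emptyset\ne R^{(d)}\subseteq R_I$ (and consequently any $\boldsymbol a_0\in R^{(d)}$ is a valid parameter, yielding an invariant $\{\boldsymbol x\mid I(\boldsymbol a_0,\boldsymbol x)\le 0\}$ of the program).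
   Context: Program data. $\boldsymbol x\in\mathbb{R}^n$ is the program state. The program is a loop with a precondition $\mathit{Pre}(\boldsymbol x)\le 0$, a postcondition $\mathit{Post}(\boldsymbol x)\le 0$, and $k$ branches: branch $i$ has guard $\boldsymbol c_i(\boldsymbol x)\le 0$ and assignment $\boldsymbol x:=\boldsymbol f_i(\boldsymbol x)$, $i=1,\dots,k$ (the guards are pairwise non-intersecting). Here $\mathit{Pre},\mathit{Post}$ are real polynomials and $\boldsymbol c_i,\boldsymbol f_i$ are (vector-valued) polynomial maps; inequalities between vectors are componentwise. States stay in a known compact set $C_{\boldsymbol x}=\{\boldsymbol x\in\mathbb{R}^n\mid h^{\boldsymbol x}_r(\boldsymbol x)\le 0,\ r=1,\dots,s_{\boldsymbol x}\}$, and a polynomial template $I(\boldsymbol a,\boldsymbol x)\in\mathbb{R}[\boldsymbol a,\boldsymbol x]$ is given with parameters $\boldsymbol a$ in a known compact set $C_{\boldsymbol a}=\{\boldsymbol a\in\mathbb{R}^m\mid h^{\boldsymbol a}_r(\boldsymbol a)\le 0,\ r=1,\dots,s_{\boldsymbol a}\}$ with $\mu(C_{\boldsymbol a})>0$; all $h^{\boldsymbol x}_r,h^{\boldsymbol a}_r$ are polynomials, and $\mu$ is Lebesgue measure. Invariants. A set $\mathit{Inv}\subseteq\mathbb{R}^n$ is an invariant of the program if for all states $\boldsymbol x\in C_{\boldsymbol x}$: (1) $\mathit{Pre}(\boldsymbol x)\le0\Rightarrow\boldsymbol x\in\mathit{Inv}$; (2) $(\boldsymbol c_i(\boldsymbol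 x)\le0\wedge\boldsymbol x\in\mathit{Inv})\Rightarrow\boldsymbol f_i(\boldsymbol x)\in\mathit{Inv}$ for $i=1,\dots,k$; (3) $(\bigwedge_{i=1}^k\boldsymbol c_i(\boldsymbol x)\ge0\wedge\boldsymbol x\in\mathit{Inv})\Rightarrow\mathit{Post}(\boldsymbol x)\le0$. A parameter $\boldsymbol a_0\in C_{\boldsymbol a}$ is valid if $\{\boldsymbol x\mid I(\boldsymbol a_0,\boldsymbol x)\le0\}$ is an invariant; the valid set $R_I$ is the set of all valid parameters. Equivalently $R_I=\bigcap_{i=0}^{k+1}R_I(i)$, where $R_I(0)=\{\boldsymbol a\in C_{\boldsymbol a}\mid\forall\boldsymbol x\in C_{\boldsymbol x}.\ \mathit{Pre}(\boldsymbol x)\le 0\Rightarrow I(\boldsymbol a,\boldsymbol x)\le 0\}$; $R_I(i)=\{\boldsymbol a\in C_{\boldsymbol a}\mid\forall\boldsymbol x\in C_{\boldsymbol x}.\ (\boldsymbol c_i(\boldsymbol x)\le 0\wedge I(\boldsymbol a,\boldsymbol x)\le 0)\Rightarrow I(\boldsymbol a,\boldsymbol f_i(\boldsymbol x))\le 0\}$ for $i=1,\dots,k$; $R_I(k+1)=\{\boldsymbol a\in C_{\boldsymbol a}\mid\forall\boldsymbol x\in C_{\boldsymbol x}.\ (\bigwedge_{i=1}^k\boldsymbol c_i(\boldsymbol x)\ge 0\wedge I(\boldsymbol a,\boldsymbol x)\le 0)\Rightarrow\mathit{Post}(\boldsymbol x)\le 0\}$. Each has the form $R_I(i)=\{\boldsymbol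 a\in C_{\boldsymbol a}\mid\forall\boldsymbol x\in\mathbf{K}_i(\boldsymbol a).\ l_i(\boldsymbol a,\boldsymbol x)\le 0\}$, where $\mathbf{K}_i(\boldsymbol a)=\{\boldsymbol x\in C_{\boldsymbol x}\mid g_{ir}(\boldsymbol a,\boldsymbol x)\le 0,\ r=1,\dots,m_i\}$, the polynomials $g_{ir}$ encode the premise of the $i$-th implication (with $\boldsymbol c_i\ge0$ written as $-\boldsymbol c_i\le0$), and $l_0=I(\boldsymbol a,\boldsymbol x)$, $l_i=I(\boldsymbol a,\boldsymbol f_i(\boldsymbol x))$ for $1\le i\le k$, $l_{k+1}=\mathit{Post}(\boldsymbol x)$. Fix a real $M>0$. For $\boldsymbol a\in C_{\boldsymbol a}$ let $\bar J_i(\boldsymbol a)=\sup_{\boldsymbol x\in\mathbf{K}_i(\boldsymbol a)}l_i(\boldsymbol a,\boldsymbol x)$ (equal to $-\infty$ if $\mathbf{K}_i(\boldsymbol a)=\emptyset$) and $J_i(\boldsymbol a)=\max(\bar J_i(\boldsymbol a),-M)$. SOS program. A quadratic module generated by $q_1,\dots,q_N$ is $\{\sigma_0+\sum_j\sigma_jq_j\}$ with $\sigma_j$ sums of squares; it is Archimedean if it contains $C-\|\cdot\|^2$ for some $C>0$. The quadratic modules corresponding to the inequality descriptions of $\mathbf{K}_i(\boldsymbol a)$, $C_{\boldsymbol a}$ and $C_{\boldsymbol x}$ (generated by the negatives of the polynomials required to be $\le 0$) are assumed Archimedean. For $d\in\mathbb{N}$, the program $\mathbf{M}_d(i)$ is: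 minimize $\sum_\alpha\gamma_\alpha\mathrm{p}^i_\alpha$ over real numbers $\mathrm{p}^i_\alpha$ ($|\alpha|\le 2d$) and sum-of-squares polynomials $\sigma_i,\sigma^K_{ir},\sigma^{\boldsymbol a}_{ir},\sigma^{\boldsymbol x}_{ir},\sigma'_i,\sigma'^K_{ir},\sigma'^{\boldsymbol a}_{ir},\sigma'^{\boldsymbol x}_{ir}$ in $(\boldsymbol a,\boldsymbol x)$ of degree at most $2d$, subject to the polynomial identities $p_i(\boldsymbol a)-l_i(\boldsymbol a,\boldsymbol x)=\sigma_i-\sum_{r=1}^{m_i}\sigma^K_{ir}g_{ir}-\sum_{r=1}^{s_{\boldsymbol a}}\sigma^{\boldsymbol a}_{ir}h^{\boldsymbol a}_r-\sum_{r=1}^{s_{\boldsymbol x}}\sigma^{\boldsymbol x}_{ir}h^{\boldsymbol x}_r$, $p_i(\boldsymbol a)+M=\sigma'_i-\sum_{r=1}^{m_i}\sigma'^K_{ir}g_{ir}-\sum_{r=1}^{s_{\boldsymbol a}}\sigma'^{\boldsymbol a}_{ir}h^{\boldsymbol a}_r-\sum_{r=1}^{s_{\boldsymbol x}}\sigma'^{\boldsymbol x}_{ir}h^{\boldsymbol x}_r$, where $p_i(\boldsymbol a)=\sum_{|\alpha|\le 2d}\mathrm{p}^i_\alpha\boldsymbol a^\alpha$ and $\gamma_\alpha=\frac{1}{\mu(C_{\boldsymbol a})}\int_{C_{\boldsymbol a}}\boldsymbol a^\alpha\,d\mu(\boldsymbol a)$. *)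

theory Defs
  imports "HOL-Analysis.Analysis" "HOL-Library.Poly_Mapping"
begin

subsection \<open>Multivariate real polynomials\<close>

text \<open>
  A polynomial maps exponent vectors (finitely supported maps from variables to exponents) to
  coefficients with finite support; the ring structure is the convolution product of
  \<^theory>\<open>HOL-Library.Poly_Mapping\<close>.
  \<open>'n mpoly\<close> is the polynomial ring in the coordinates of \<open>real ^ 'n\<close>, and
  \<open>('m + 'n) mpoly\<close> is the polynomial ring in the joint variables (a, x) with
  \<open>a :: real ^ 'm\<close> and \<open>x :: real ^ 'n\<close>.
\<close>

type_synonym 'v mpoly = "('v \<Rightarrow>\<^sub>0 nat) \<Rightarrow>\<^sub>0 real"

definition mconst :: "real \<Rightarrow> 'v mpoly" where
  "mconst r = Poly_Mapping.single 0 r"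

definition mvar :: "'v \<Rightarrow> 'v mpoly" where
  "mvar v = Poly_Mapping.single (Poly_Mapping.single v 1) 1"

definition monom_eval :: "('v \<Rightarrow>\<^sub>0 nat) \<Rightarrow> ('v \<Rightarrow> 'b) \<Rightarrow> 'b::comm_monoid_mult" where
  "monom_eval \<alpha> x = (\<Prod>v\<in>Poly_Mapping.keys \<alpha>. x v ^ Poly_Mapping.lookup \<alpha> v)"

definition meval :: "'v mpoly \<Rightarrow> ('v \<Rightarrow> real) \<Rightarrow> real" where
  "meval p x = (\<Sum>\<alpha>\<in>Poly_Mapping.keys p. Poly_Mapping.lookup p \<alpha> * monom_eval \<alpha> x)"

definition msubst :: "('v \<Rightarrow> 'w mpoly) \<Rightarrow> 'v mpoly \<Rightarrow> 'w mpoly" where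
  "msubst s p = (\<Sum>\<alpha>\<in>Poly_Mapping.keys p. mconst (Poly_Mapping.lookup p \<alpha>) * monom_eval \<alpha> s)"

definition monom_deg :: "('v \<Rightarrow>\<^sub>0 nat) \<Rightarrow> nat" where
  "monom_deg \<alpha> = (\<Sum>v\<in>Poly_Mapping.keys \<alpha>. Poly_Mapping.lookup \<alpha> v)"

definition total_deg :: "'v mpoly \<Rightarrow> nat" where
  "total_deg p = Max (insert 0 (monom_deg ` Poly_Mapping.keys p))"

definition in_params :: "'m mpoly \<Rightarrow> ('m + 'n) mpoly" where
  "in_params = msubst (\<lambda>j. mvar (Inl j))"

definition in_state :: "'n mpoly \<Rightarrow> ('m + 'n) mpoly" where
  "in_state = msubst (\<lambda>v. mvar (Inr v))"

definition at_params :: "real ^ 'm \<Rightarrow> ('m + 'n) mpoly \<Rightarrow> 'n mpoly" where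
  "at_params a = msubst (case_sum (\<lambda>j. mconst (a $ j)) mvar)"

definition peval :: "'n mpoly \<Rightarrow> real ^ 'n \<Rightarrow> real" where
  "peval p x = meval p (\<lambda>v. x $ v)"

definition peval2 :: "('m + 'n) mpoly \<Rightarrow> real ^ 'm \<Rightarrow> real ^ 'n \<Rightarrow> real" where
  "peval2 p a x = meval p (case_sum (\<lambda>j. a $ j) (\<lambda>v. x $ v))"


subsection \<open>Sums of squares and quadratic modules\<close>

definition sos :: "'v mpoly \<Rightarrow> bool" where
  "sos p \<longleftrightarrow> (\<exists>qs. p = (\<Sum>q\<leftarrow>qs. q ^ 2))"

definition quadratic_module :: "'v mpoly list \<Rightarrow> 'v mpoly set" where
  "quadratic_module qs =
    {\<sigma>0 + (\<Sum>j<length qs. \<sigma> j * qs ! j) | \<sigma>0 \<sigma>. sos \<sigma>0 \<and> (\<forall>j<length qs. sos (\<sigma> j))}"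

definition archimedean :: "'v::finite mpoly set \<Rightarrow> bool" where
  "archimedean Q \<longleftrightarrow> (\<exists>C>0. mconst C - (\<Sum>v\<in>UNIV. mvar v ^ 2) \<in> Q)"


subsection \<open>Programs and invariants\<close>

definition basic_set :: "'n mpoly list \<Rightarrow> (real ^ 'n) set" where
  "basic_set hs = {x. \<forall>h\<in>set hs. peval h x \<le> 0}"

text \<open>
  A program with \<open>k\<close> branches is given by \<open>Pre\<close>, \<open>Post\<close>, the guards \<open>c i\<close> (the list of components
  of a vector-valued polynomial map) and the assignments \<open>f i\<close> (one polynomial per coordinate)
  for \<open>i = 1, ..., k\<close>.
\<close>

definition invariant ::
    "nat \<Rightarrow> 'n mpoly \<Rightarrow> 'n mpoly \<Rightarrow> (nat \<Rightarrow> 'n mpoly list) \<Rightarrow> (nat \<Rightarrow> 'n \<Rightarrow> 'n mpoly) \<Rightarrow>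
      (real ^ 'n) set \<Rightarrow> (real ^ 'n) set \<Rightarrow> bool" where
  "invariant k Pre Post c f Cx Inv \<longleftrightarrow> (\<forall>x\<in>Cx.
    (peval Pre x \<le> 0 \<longrightarrow> x \<in> Inv) \<and>
    (\<forall>i\<in>{1..k}. (\<forall>q\<in>set (c i). peval q x \<le> 0) \<and> x \<in> Inv \<longrightarrow> (\<chi> v. peval (f i v) x) \<in> Inv) \<and>
    ((\<forall>i\<in>{1..k}. \<forall>q\<in>set (c i). peval q x \<ge> 0) \<and> x \<in> Inv \<longrightarrow> peval Post x \<le> 0))"

definition candidate :: "('m + 'n) mpoly \<Rightarrow> real ^ 'm \<Rightarrow> (real ^ 'n) set" where
  "candidate T a = {x. peval2 T a x \<le> 0}"

definition valid_set ::
    "nat \<Rightarrow> 'n::finite mpoly \<Rightarrow> 'n mpoly \<Rightarrow> (nat \<Rightarrow> 'n mpoly list) \<Rightarrow> (nat \<Rightarrow> 'n \<Rightarrow> 'n mpoly) \<Rightarrow>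
      'n mpoly list \<Rightarrow> 'm mpoly list \<Rightarrow> ('m + 'n) mpoly \<Rightarrow> (real ^ 'm) set" where
  "valid_set k Pre Post c f hx ha T =
    {a \<in> basic_set ha. invariant k Pre Post c f (basic_set hx) (candidate T a)}"

text \<open>
  The verification conditions, indexed by \<open>i = 0, ..., k + 1\<close>: \<open>premise\<close> lists the polynomials
  \<open>g\<^sub>i\<^sub>r\<close> and \<open>target\<close> is \<open>l\<^sub>i\<close>, so that condition \<open>i\<close> at parameter \<open>a\<close> states
  \<open>l\<^sub>i(a, x) \<le> 0\<close> for all \<open>x\<close> in \<open>K\<^sub>i(a)\<close>.
\<close>

definition premise ::
    "nat \<Rightarrow> 'n mpoly \<Rightarrow> (nat \<Rightarrow> 'n mpoly list) \<Rightarrow> ('m + 'n) mpoly \<Rightarrow> nat \<Rightarrow> ('m + 'n) mpoly list"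
    where
  "premise k Pre c T i =
    (if i = 0 then [in_state Pre]
     else if i \<le> k then map in_state (c i) @ [T]
     else concat (map (\<lambda>j. map (\<lambda>q. - in_state q) (c j)) [1..<Suc k]) @ [T])"

definition target ::
    "nat \<Rightarrow> 'n mpoly \<Rightarrow> (nat \<Rightarrow> 'n \<Rightarrow> 'n mpoly) \<Rightarrow> ('m + 'n) mpoly \<Rightarrow> nat \<Rightarrow> ('m + 'n) mpoly" where
  "target k Post f T i =
    (if i = 0 then T
     else if i \<le> k then msubst (case_sum (\<lambda>j. mvar (Inl j)) (\<lambda>v. in_state (f i v))) T
     else in_state Post)"

text \<open>
  From here on \<open>gs\<close> and \<open>l\<close> stand for the premise list and the target of one verification condition.
\<close>

definition Kset :: "'n mpoly list \<Rightarrow> ('m + 'n) mpoly list \<Rightarrow> real ^ 'm \<Rightarrow> (real ^ 'n) set" where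
  "Kset hx gs a = {x \<in> basic_set hx. \<forall>g\<in>set gs. peval2 g a x \<le> 0}"

text \<open>The supremum is taken in the extended reals, where the empty supremum is \<open>-\<infinity>\<close>.\<close>

definition Jbar :: "'n::finite mpoly list \<Rightarrow> ('m + 'n) mpoly list \<Rightarrow> ('m + 'n) mpoly \<Rightarrow> real ^ 'm \<Rightarrow> ereal"
    where
  "Jbar hx gs l a = (SUP x\<in>Kset hx gs a. ereal (peval2 l a x))"

definition Jfun ::
    "real \<Rightarrow> 'n::finite mpoly list \<Rightarrow> ('m + 'n) mpoly list \<Rightarrow> ('m + 'n) mpoly \<Rightarrow> real ^ 'm \<Rightarrow> ereal" where
  "Jfun M hx gs l a = max (Jbar hx gs l a) (ereal (- M))"


subsection \<open>The sum-of-squares programs\<close>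

definition moment :: "'m::finite mpoly list \<Rightarrow> ('m \<Rightarrow>\<^sub>0 nat) \<Rightarrow> real" where
  "moment ha \<alpha> =
    1 / measure lebesgue (basic_set ha) *
    (LINT a:basic_set ha|lebesgue. monom_eval \<alpha> (\<lambda>j. a $ j))"

definition sos_deg :: "nat \<Rightarrow> 'v mpoly \<Rightarrow> bool" where
  "sos_deg d \<sigma> \<longleftrightarrow> sos \<sigma> \<and> total_deg \<sigma> \<le> 2 * d"

definition sos_representation ::
    "nat \<Rightarrow> 'm mpoly list \<Rightarrow> 'n mpoly list \<Rightarrow> ('m + 'n) mpoly list \<Rightarrow> ('m + 'n) mpoly \<Rightarrow> bool" where
  "sos_representation d ha hx gs q \<longleftrightarrow> (\<exists>\<sigma> \<sigma>K \<sigma>a \<sigma>x.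
    sos_deg d \<sigma> \<and>
    (\<forall>r<length gs. sos_deg d (\<sigma>K r)) \<and>
    (\<forall>r<length ha. sos_deg d (\<sigma>a r)) \<and>
    (\<forall>r<length hx. sos_deg d (\<sigma>x r)) \<and>
    q = \<sigma> - (\<Sum>r<length gs. \<sigma>K r * gs ! r)
          - (\<Sum>r<length ha. \<sigma>a r * in_params (ha ! r))
          - (\<Sum>r<length hx. \<sigma>x r * in_state (hx ! r)))"

text \<open>
  The decision variables with index \<open>\<alpha>\<close> are the coefficients of the polynomial \<open>p\<close> of degree at
  most \<open>2 * d\<close>; the multipliers do not enter the objective and are existentially quantified.
\<close>

definition sos_feasible ::
    "nat \<Rightarrow> real \<Rightarrow> 'm mpoly list \<Rightarrow> 'n mpoly list \<Rightarrow> ('m + 'n) mpoly list \<Rightarrow> ('m + 'n) mpoly \<Rightarrow>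
      'm mpoly \<Rightarrow> bool" where
  "sos_feasible d M ha hx gs l p \<longleftrightarrow>
    total_deg p \<le> 2 * d \<and>
    sos_representation d ha hx gs (in_params p - l) \<and>
    sos_representation d ha hx gs (in_params p + mconst M)"

definition sos_objective :: "nat \<Rightarrow> 'm mpoly list \<Rightarrow> 'm::finite mpoly \<Rightarrow> real" where
  "sos_objective d ha p = (\<Sum>\<alpha> | monom_deg \<alpha> \<le> 2 * d. moment ha \<alpha> * Poly_Mapping.lookup p \<alpha>)"

definition sos_optimal ::
    "nat \<Rightarrow> real \<Rightarrow> 'm mpoly list \<Rightarrow> 'n mpoly list \<Rightarrow> ('m + 'n) mpoly list \<Rightarrow> ('m + 'n) mpoly \<Rightarrow>
      'm::finite mpoly \<Rightarrow> bool" where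
  "sos_optimal d M ha hx gs l p \<longleftrightarrow>
    sos_feasible d M ha hx gs l p \<and>
    (\<forall>q. sos_feasible d M ha hx gs l q \<longrightarrow> sos_objective d ha p \<le> sos_objective d ha q)"

definition approx_param_set :: "nat \<Rightarrow> 'm mpoly list \<Rightarrow> (nat \<Rightarrow> 'm mpoly) \<Rightarrow> (real ^ 'm) set" where
  "approx_param_set k ha p = (\<Inter>i\<in>{0..k + 1}. {a \<in> basic_set ha. peval (p i) a \<le> 0})"

end

(*
  On C_a the value functions J_i are upper semicontinuous, so they are decreasing limits of
  continuous functions and, by Stone-Weierstrass, are approximated in L1 from strictly above by
  polynomials q. Such a q satisfies the constraints of M_d(i) for large d by Putinar's
  Positivstellensatz, so the optimal values converge to the mean of J_i. Solvability for all d
  forces K_i(a) to be nonempty for almost every a, hence p_i^(d) >= J_i almost everywhere, and the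
  p_i^(d) converge to J_i in L1. Almost everywhere in the interior of R_I every J_i is negative, so
  by Markov's inequality the part of the interior where some p_i^(d) is positive has arbitrarily
  small measure.

  Putinar's theorem is proved without functional analysis. If f > 0 wherever all g_i >= 0, then
  F = f - r * sum_i (1 - g_i)^(2n) g_i (with the g_i scaled) is positive on a cube around the ball
  |x|^2 <= C given by the Archimedean property. The quadratic module of the single polynomial
  C - |x|^2 is closed under products and contains the affine forms that define the cube, hence it
  contains F by the Bernstein expansion of F.
*)
theory Submission
  imports Defs
begin

text \<open>The inclusion holds at every degree, since a feasible \<open>p\<close> dominates the
  target on each K_i(a); a large d is needed only for non-emptiness. L1 convergence says nothing at
  a prescribed parameter, and validity gives only J_i \<le> 0: where J_i = 0, upper bounds
  converging in mean may stay positive forever. Hence the null-set hypothesis, and hence a measure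
  count instead of a chosen point: k + 2 exceptional sets, each smaller than the (k + 2)-th part of
  an open set of positive measure, cannot cover it. J_i need not be continuous, because K_i(a) can
  shrink abruptly as a moves. Upper semicontinuity is what survives, and it suffices because
  approximation is required from above only. The approximation must be strict, because Putinar's
  theorem asks for strict positivity. In that theorem, subtracting weighted generators trades
  positivity on the feasible set for positivity on a whole cube. This is worthwhile because a module
  with several generators is in general not closed under products, whereas one with a single
  generator is.\<close>

section \<open>Evaluation of multivariate polynomials\<close>

lemma monom_eval_UNIV: "monom_eval \<alpha> s = (\<Prod>v\<in>UNIV. s v ^ Poly_Mapping.lookup \<alpha> v)"
  for s :: "'v::finite \<Rightarrow> 'b::comm_monoid_mult"
  unfolding monom_eval_def by (rule prod.mono_neutral_left) (auto simp: in_keys_iff)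

lemma monom_eval_0 [simp]: "monom_eval 0 s = 1"
  by (simp add: monom_eval_def)

lemma monom_eval_add: "monom_eval (\<alpha> + \<beta>) s = monom_eval \<alpha> s * monom_eval \<beta> s"
  for s :: "'v::finite \<Rightarrow> 'b::comm_monoid_mult"
  by (simp add: monom_eval_UNIV lookup_add power_add prod.distrib)

lemma monom_eval_single: "monom_eval (Poly_Mapping.single v 1) s = s v"
  by (simp add: monom_eval_def)

lemma sum_monomials:
  "(\<Sum>\<alpha>\<in>Poly_Mapping.keys p. Poly_Mapping.single \<alpha> (Poly_Mapping.lookup p \<alpha>)) = p"
  by (rule poly_mapping_eqI)
    (auto simp: lookup_sum lookup_single when_def in_keys_iff sum.delta' cong: if_cong)

text \<open>Evaluation at a point and substitution of polynomials are the same construction over two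
  coefficient maps, the identity on the reals and \<open>mconst\<close>; the homomorphism laws are
  proved once for both.\<close>

locale coeff_hom =
  fixes h :: "real \<Rightarrow> 'b::comm_ring_1"
  assumes hom_add: "h (x + y) = h x + h y"
    and hom_mult: "h (x * y) = h x * h y"
    and hom_1: "h 1 = 1"
begin

definition heval :: "('v \<Rightarrow> 'b) \<Rightarrow> 'v mpoly \<Rightarrow> 'b" where
  "heval s p = (\<Sum>\<alpha>\<in>Poly_Mapping.keys p. h (Poly_Mapping.lookup p \<alpha>) * monom_eval \<alpha> s)"

lemma hom_0: "h 0 = 0"
  using hom_add[of 0 0] by simp

lemma heval_superset:
  assumes "finite A" "Poly_Mapping.keys p \<subseteq> A"
  shows "heval s p = (\<Sum>\<alpha>\<in>A. h (Poly_Mapping.lookup p \<alpha>) * monom_eval \<alpha> s)"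
  unfolding heval_def using assms
  by (intro sum.mono_neutral_left) (auto simp: in_keys_iff hom_0)

lemma heval_0: "heval s 0 = 0"
  by (simp add: heval_def)

lemma heval_add: "heval s (p + q) = heval s p + heval s q"
proof -
  let ?A = "Poly_Mapping.keys p \<union> Poly_Mapping.keys q"
  have "heval s (p + q) = (\<Sum>\<alpha>\<in>?A. h (Poly_Mapping.lookup (p + q) \<alpha>) * monom_eval \<alpha> s)"
    by (rule heval_superset) (auto simp: Poly_Mapping.keys_add)
  also have "\<dots> = heval s p + heval s q"
    by (simp add: heval_superset[of ?A] lookup_add hom_add sum.distrib distrib_right)
  finally show ?thesis .
qed

lemma heval_sum: "heval s (\<Sum>i\<in>I. p i) = (\<Sum>i\<in>I. heval s (p i))"
  by (induction I rule: infinite_finite_induct) (simp_all add: heval_0 heval_add)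

lemma heval_single: "heval s (Poly_Mapping.single \<alpha> r) = h r * monom_eval \<alpha> s"
  by (cases "r = 0") (simp_all add: heval_def hom_0)

lemma heval_mult: "heval s (p * q) = heval s p * heval s q" for s :: "'v::finite \<Rightarrow> 'b"
proof -
  have "p * q = (\<Sum>\<alpha>\<in>Poly_Mapping.keys p. \<Sum>\<beta>\<in>Poly_Mapping.keys q.
      Poly_Mapping.single (\<alpha> + \<beta>) (Poly_Mapping.lookup p \<alpha> * Poly_Mapping.lookup q \<beta>))"
    by (subst sum_monomials[of p, symmetric], subst sum_monomials[of q, symmetric])
      (simp add: sum_product mult_single)
  then have "heval s (p * q) = (\<Sum>\<alpha>\<in>Poly_Mapping.keys p. \<Sum>\<beta>\<in>Poly_Mapping.keys q.
      h (Poly_Mapping.lookup p \<alpha>) * h (Poly_Mapping.lookup q \<beta>) * (monom_eval \<alpha> s * monom_eval \<beta> s))"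
    by (simp only: heval_sum heval_single hom_mult monom_eval_add)
  then show ?thesis
    by (simp add: heval_def sum_product mult_ac)
qed

lemma heval_mconst: "heval s (mconst r) = h r"
  by (simp add: mconst_def heval_single)

lemma heval_mvar: "heval s (mvar v) = s v"
  by (simp add: mvar_def heval_single monom_eval_single hom_1 del: One_nat_def)

lemma heval_1: "heval s 1 = 1"
  using heval_mconst[of s 1] by (simp add: mconst_def hom_1)

lemma heval_uminus: "heval s (- p) = - heval s p"
  using heval_add[of s p "- p"] by (simp add: heval_0 eq_neg_iff_add_eq_0 add.commute)

lemma heval_diff: "heval s (p - q) = heval s p - heval s q"
  using heval_add[of s p "- q"] by (simp add: heval_uminus)

lemma heval_power: "heval s (p ^ n) = heval s p ^ n" for s :: "'v::finite \<Rightarrow> 'b"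
  by (induction n) (simp_all add: heval_1 heval_mult)

lemma heval_prod: "heval s (\<Prod>i\<in>I. p i) = (\<Prod>i\<in>I. heval s (p i))" for s :: "'v::finite \<Rightarrow> 'b"
  by (induction I rule: infinite_finite_induct) (simp_all add: heval_1 heval_mult)

lemma heval_monom_eval: "heval s (monom_eval \<alpha> t) = monom_eval \<alpha> (\<lambda>v. heval s (t v))"
  for s :: "'v::finite \<Rightarrow> 'b"
  by (simp add: monom_eval_def heval_prod heval_power)

lemma heval_msubst: "heval s (msubst t p) = heval (\<lambda>v. heval s (t v)) p"
  for s :: "'v::finite \<Rightarrow> 'b"
  by (simp add: msubst_def heval_sum heval_mult heval_mconst heval_monom_eval heval_def[of _ p])

end

interpretation meval: coeff_hom "\<lambda>x::real. x"
  rewrites "meval.heval s p = meval p s"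
proof -
  show "coeff_hom (\<lambda>x::real. x)"
    by unfold_locales auto
  then interpret coeff_hom "\<lambda>x::real. x" .
  show "heval s p = meval p s"
    by (simp add: heval_def meval_def)
qed

interpretation msubst: coeff_hom "mconst :: real \<Rightarrow> 'w mpoly"
  rewrites "msubst.heval s p = msubst s p"
proof -
  show "coeff_hom (mconst :: real \<Rightarrow> 'w mpoly)"
    by unfold_locales (simp_all add: mconst_def single_add mult_single)
  then interpret coeff_hom "mconst :: real \<Rightarrow> 'w mpoly" .
  show "heval s p = msubst s p"
    by (simp add: heval_def msubst_def)
qed

lemmas meval_hom [simp] = meval.heval_0 meval.heval_1 meval.heval_add meval.heval_mult meval.heval_diff
  meval.heval_uminus meval.heval_power meval.heval_sum meval.heval_mconst meval.heval_mvar
  meval.heval_msubst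
lemmas msubst_hom [simp] = msubst.heval_0 msubst.heval_1 msubst.heval_add msubst.heval_mult msubst.heval_diff
  msubst.heval_uminus msubst.heval_power msubst.heval_sum msubst.heval_mconst msubst.heval_mvar
lemmas mconst_hom = msubst.hom_0 msubst.hom_1 msubst.hom_add msubst.hom_mult

text \<open>Used to cancel an affine change of variables against its inverse.\<close>

lemma msubst_mvar: "msubst mvar p = p" for p :: "'v::finite mpoly"
proof -
  have power: "mvar v ^ n = Poly_Mapping.single (Poly_Mapping.single v n) 1" for v :: 'v and n
    by (induction n) (simp_all add: mvar_def mult_single flip: single_add)
  have prod: "(\<Prod>v\<in>A. Poly_Mapping.single (\<beta> v) 1) = Poly_Mapping.single (\<Sum>v\<in>A. \<beta> v) (1::real)"
    for A :: "'v set" and \<beta> :: "'v \<Rightarrow> 'v \<Rightarrow>\<^sub>0 nat"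
    by (induction A rule: infinite_finite_induct) (simp_all add: mult_single)
  have "(\<Sum>v\<in>UNIV. Poly_Mapping.single v (Poly_Mapping.lookup \<alpha> v)) = \<alpha>" for \<alpha> :: "'v \<Rightarrow>\<^sub>0 nat"
    by (rule poly_mapping_eqI) (simp add: lookup_sum lookup_single when_def)
  then have "monom_eval \<alpha> mvar = Poly_Mapping.single \<alpha> 1" for \<alpha> :: "'v \<Rightarrow>\<^sub>0 nat"
    by (simp add: monom_eval_UNIV power prod)
  then show ?thesis
    by (simp add: msubst_def mconst_def mult_single sum_monomials)
qed

lemma continuous_on_meval:
  assumes "\<And>v. continuous_on S (\<lambda>x. s x v)"
  shows "continuous_on S (\<lambda>x. meval p (s x))"
  unfolding meval_def monom_eval_def by (intro continuous_intros assms)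

lemma continuous_on_peval: "continuous_on S (peval p)"
  unfolding peval_def by (intro continuous_on_meval continuous_intros)

lemma continuous_on_peval2: "continuous_on S (\<lambda>(a, x). peval2 p a x)"
  unfolding peval2_def case_prod_beta
proof (rule continuous_on_meval)
  show "continuous_on S (\<lambda>z. case_sum (($) (fst z)) (($) (snd z)) v)" for v
    by (cases v) (simp_all add: continuous_intros)
qed

lemma peval2_in_params [simp]: "peval2 (in_params q) a x = peval q a"
  for q :: "'m::finite mpoly" and x :: "real ^ 'n::finite"
  by (simp add: peval2_def in_params_def peval_def)

lemma peval2_in_state [simp]: "peval2 (in_state q) a x = peval q x"
  for q :: "'n::finite mpoly" and a :: "real ^ 'm::finite"
  by (simp add: peval2_def in_state_def peval_def)

section \<open>Sums of squares\<close>

lemma sos_0 [simp]: "sos 0"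
  unfolding sos_def by (rule exI[of _ "[]"]) simp

lemma sos_square [simp]: "sos (q ^ 2)"
  unfolding sos_def by (rule exI[of _ "[q]"]) simp

lemma sos_1 [simp]: "sos 1"
  using sos_square[of 1] by simp

lemma sos_add: "sos p \<Longrightarrow> sos q \<Longrightarrow> sos (p + q)"
  unfolding sos_def by (metis map_append sum_list.append)

lemma sos_sum: "(\<And>i. i \<in> I \<Longrightarrow> sos (p i)) \<Longrightarrow> sos (\<Sum>i\<in>I. p i)"
  by (induction I rule: infinite_finite_induct) (simp_all add: sos_add)

lemma sos_mult:
  assumes "sos p" "sos q"
  shows "sos (p * q)"
proof -
  obtain ps qs where pq: "p = (\<Sum>r\<leftarrow>ps. r ^ 2)" "q = (\<Sum>r\<leftarrow>qs. r ^ 2)"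
    using assms by (auto simp: sos_def)
  have *: "sos (r ^ 2 * (\<Sum>r\<leftarrow>qs. r ^ 2))" for r
    unfolding sos_def sum_list_const_mult[symmetric]
    by (rule exI[of _ "map ((*) r) qs"]) (simp add: power_mult_distrib comp_def)
  show ?thesis
    unfolding pq(1) pq(2) by (induction ps) (simp_all add: distrib_right sos_add *)
qed

lemma sos_mconst: "0 \<le> r \<Longrightarrow> sos (mconst r)"
  using sos_square[of "mconst (sqrt r)"] by (simp add: power2_eq_square flip: msubst.hom_mult)

lemma sos_nonneg: "sos p \<Longrightarrow> 0 \<le> meval p x" for x :: "'v::finite \<Rightarrow> real"
proof -
  assume "sos p"
  then obtain qs where "p = (\<Sum>q\<leftarrow>qs. q ^ 2)"
    by (auto simp: sos_def)
  then show ?thesis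
    by (induction qs arbitrary: p) auto
qed

section \<open>Polynomials positive on a cube\<close>

lemma mconst_of_nat: "mconst (of_nat n) = of_nat n"
  by (simp add: mconst_def)

text \<open>Multiply \<open>u ^ j\<close> by \<open>(u + (1 - u)) ^ (m - j) = 1\<close> and expand;
  the coefficients match by C(m,i) C(i,j) = C(m,j) C(m-j,i-j). It is a ring identity, so
  \<open>u\<close> may itself be a polynomial.\<close>

lemma power_eq_bernstein_sum:
  fixes u :: "'w mpoly"
  assumes "j \<le> m"
  shows "u ^ j = (\<Sum>i\<le>m. mconst (real (i choose j) / real (m choose j)) *
    (of_nat (m choose i) * u ^ i * (1 - u) ^ (m - i)))"
proof -
  let ?t = "\<lambda>i. mconst (real (i choose j) / real (m choose j)) *
    (of_nat (m choose i) * u ^ i * (1 - u) ^ (m - i))"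
  have coeff: "mconst (real ((l + j) choose j) / real (m choose j)) * of_nat (m choose (l + j)) =
      (of_nat ((m - j) choose l) :: 'w mpoly)" if "l \<le> m - j" for l
  proof -
    have "(m choose (l + j)) * ((l + j) choose j) = (m choose j) * ((m - j) choose l)"
      using choose_mult[of j "l + j" m] that assms by simp
    then have "real ((l + j) choose j) * real (m choose (l + j)) = real (m choose j) * real ((m - j) choose l)"
      by (metis of_nat_mult mult.commute)
    moreover have "real (m choose j) \<noteq> 0"
      using assms by simp
    ultimately show ?thesis
      by (simp add: field_simps flip: msubst.hom_mult mconst_of_nat)
  qed
  have "u ^ j = u ^ j * (u + (1 - u)) ^ (m - j)"
    by simp
  also have "\<dots> = (\<Sum>l\<le>m - j. u ^ j * (of_nat ((m - j) choose l) * u ^ l * (1 - u) ^ (m - j - l)))"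
    by (subst binomial_ring) (simp add: sum_distrib_left)
  also have "\<dots> = (\<Sum>l\<le>m - j. ?t (l + j))"
    by (rule sum.cong) (auto simp: coeff[symmetric] power_add mult_ac add.commute)
  also have "\<dots> = (\<Sum>i\<in>{j..m}. ?t i)"
    by (rule sum.reindex_bij_witness[of _ "\<lambda>i. i - j" "\<lambda>l. l + j"]) (use assms in auto)
  \<comment> \<open>The terms added here have \<open>i < j\<close>, so \<open>i choose j\<close> is
    0.\<close>
  also have "\<dots> = (\<Sum>i\<le>m. ?t i)"
    by (rule sum.mono_neutral_left) (auto simp: not_le binomial_eq_0 msubst.hom_0)
  finally show ?thesis .
qed

text \<open>Both quantities are products of \<open>j\<close> factors, (i - s)/(m - s) against i/m,
  of absolute value at most 1. Such products differ by at most the sum of the differences of their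
  factors, each at most D/(m - D).\<close>

lemma bernstein_coefficient_bound:
  assumes "j \<le> D" "i \<le> m" "2 * D < m"
  shows "\<bar>real (i choose j) / real (m choose j) - (real i / real m) ^ j\<bar> \<le> (real D)\<^sup>2 / (real m - real D)"
proof -
  let ?z = "\<lambda>s. (real i - real s) / (real m - real s)"
  have fact: "real (n choose j) = (\<Prod>s<j. real n - real s) / fact j" for n
    by (simp add: binomial_gbinomial gbinomial_prod_rev atLeast0LessThan)
  have "real (i choose j) / real (m choose j) = (\<Prod>s<j. ?z s)"
    unfolding fact by (simp add: prod_dividef)
  moreover have "\<bar>(\<Prod>s<j. ?z s) - (\<Prod>s<j. real i / real m)\<bar> \<le> (\<Sum>s<j. \<bar>?z s - real i / real m\<bar>)"
  proof -
    \<comment> \<open>For \<open>i < s\<close> the factor is negative; \<open>2 * D < m\<close>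
      keeps it above -1.\<close>
    have "\<bar>?z s\<bar> \<le> 1" if "s < j" for s
      using that assms by (auto simp: abs_le_iff field_simps)
    then show ?thesis
      using norm_prod_diff[of "{..<j}" ?z "\<lambda>s. real i / real m"] assms by auto
  qed
  moreover have "(\<Sum>s<j. \<bar>?z s - real i / real m\<bar>) \<le> (\<Sum>s<j. real D / (real m - real D))"
  proof (rule sum_mono)
    fix s assume "s \<in> {..<j}"
    then have s: "s < D" "s < m"
      using assms by auto
    have "?z s - real i / real m = - (real s * ((real m - real i) / real m) / (real m - real s))"
      using s by (simp add: field_simps)
    then have "\<bar>?z s - real i / real m\<bar> = real s * ((real m - real i) / real m) / (real m - real s)"
      using s assms by simp
    also have "\<dots> \<le> real D * 1 / (real m - real D)"
      using s assms by (intro frac_le mult_mono) (auto simp: field_simps)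
    finally show "\<bar>?z s - real i / real m\<bar> \<le> real D / (real m - real D)"
      by simp
  qed
  moreover have "(\<Sum>s<j. real D / (real m - real D)) \<le> (real D)\<^sup>2 / (real m - real D)"
    using assms by (auto simp: power2_eq_square intro!: divide_right_mono mult_right_mono)
  ultimately show ?thesis
    by simp
qed

text \<open>
  The Bernstein coefficients of \<open>f\<close> of degree \<open>m\<close> in each variable converge uniformly to the values
  of \<open>f\<close> at the grid points \<open>\<iota> / m\<close>, so they are eventually positive.
\<close>

lemma positive_on_cube_in_semiring:
  fixes f :: "'v::finite mpoly" and u :: "'v \<Rightarrow> 'w mpoly"
  assumes pos: "\<And>x. (\<And>v. 0 \<le> x v \<and> x v \<le> 1) \<Longrightarrow> 0 < meval f x"
    and const: "\<And>r. 0 \<le> r \<Longrightarrow> mconst r \<in> A"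
    and add: "\<And>p q. p \<in> A \<Longrightarrow> q \<in> A \<Longrightarrow> p + q \<in> A"
    and mult: "\<And>p q. p \<in> A \<Longrightarrow> q \<in> A \<Longrightarrow> p * q \<in> A"
    and u: "\<And>v. u v \<in> A" "\<And>v. 1 - u v \<in> A"
  shows "msubst u f \<in> A"
proof -
  let ?a = "Poly_Mapping.lookup f" and ?K = "Poly_Mapping.keys f"
  obtain \<mu> where \<mu>: "0 < \<mu>" "\<And>x. (\<And>v. 0 \<le> x v \<and> x v \<le> 1) \<Longrightarrow> \<mu> \<le> meval f x"
  proof -
    let ?C = "cbox (\<chi> v. 0) (\<chi> v. 1) :: (real ^ 'v) set"
    have memC: "y \<in> ?C \<longleftrightarrow> (\<forall>v. 0 \<le> y $ v \<and> y $ v \<le> 1)" for y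
      by (simp add: mem_box_cart)
    have "?C \<noteq> {}"
      using memC[of "\<chi> v. 0"] by force
    then obtain y where y: "y \<in> ?C" "\<And>z. z \<in> ?C \<Longrightarrow> peval f y \<le> peval f z"
      using continuous_attains_inf[of ?C "peval f"] continuous_on_peval compact_cbox by blast
    show thesis
    proof (rule that[of "peval f y"])
      show "0 < peval f y"
        using y(1) memC pos by (simp add: peval_def)
      show "peval f y \<le> meval f x" if "\<And>v. 0 \<le> x v \<and> x v \<le> 1" for x
        using y(2)[of "\<chi> v. x v"] that memC by (simp add: peval_def)
    qed
  qed
  \<comment> \<open>A crude bound for all exponents of all variables occurring in
    \<open>f\<close>.\<close>
  define D where "D = (\<Sum>\<alpha>\<in>?K. \<Sum>v\<in>UNIV. Poly_Mapping.lookup \<alpha> v)"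
  have D: "Poly_Mapping.lookup \<alpha> v \<le> D" if "\<alpha> \<in> ?K" for \<alpha> v
  proof -
    have "Poly_Mapping.lookup \<alpha> v \<le> (\<Sum>v\<in>UNIV. Poly_Mapping.lookup \<alpha> v)"
      by (rule member_le_sum) auto
    also have "\<dots> \<le> D"
      unfolding D_def by (rule member_le_sum) (use that in auto)
    finally show ?thesis .
  qed
  \<comment> \<open>\<open>R / (m - D)\<close> is the total error of a Bernstein coefficient: the
    absolute coefficients of \<open>f\<close> times the number of variables times the error per
    variable. \<open>m\<close> is then taken so large that this is below the minimum \<mu> of
    \<open>f\<close>.\<close>
  define R where "R = (\<Sum>\<alpha>\<in>?K. \<bar>?a \<alpha>\<bar>) * real CARD('v) * (real D)\<^sup>2"
  have "R \<ge> 0"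
    by (simp add: R_def sum_nonneg)
  obtain m0 where "R / \<mu> < real m0"
    using reals_Archimedean2 by blast
  define m where "m = Suc (m0 + 2 * D)"
  have m: "2 * D < m" "R / (real m - real D) < \<mu>"
  proof -
    have "R < \<mu> * real m0"
      using \<open>R / \<mu> < real m0\<close> \<mu>(1) by (simp add: field_simps)
    also have "\<dots> \<le> \<mu> * (real m - real D)"
      using \<mu>(1) by (intro mult_left_mono) (auto simp: m_def)
    finally show "R / (real m - real D) < \<mu>"
      by (simp add: m_def field_simps)
  qed (simp add: m_def)
  have Dm: "Poly_Mapping.lookup \<alpha> v \<le> m" if "\<alpha> \<in> ?K" for \<alpha> v
    using D[OF that, of v] m(1) by linarith
  define B where "B i v = of_nat (m choose i) * u v ^ i * (1 - u v) ^ (m - i)" for i v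
  define c where "c i j = real (i choose j) / real (m choose j)" for i j
  define b where "b \<iota> = (\<Sum>\<alpha>\<in>?K. ?a \<alpha> * (\<Prod>v\<in>UNIV. c (\<iota> v) (Poly_Mapping.lookup \<alpha> v)))" for \<iota> :: "'v \<Rightarrow> nat"
  let ?I = "PiE UNIV (\<lambda>_::'v. {..m})"
  have mconst_prod: "mconst (\<Prod>v\<in>X. g v) = (\<Prod>v\<in>X. mconst (g v))" for X and g :: "'v \<Rightarrow> real"
    by (induction X rule: infinite_finite_induct) (simp_all add: mconst_hom)
  have A1: "1 \<in> A" "0 \<in> A"
    using const[of 1] const[of 0] by (simp_all add: mconst_hom)
  have power: "p ^ n \<in> A" if "p \<in> A" for p n
    by (induction n) (use A1 mult that in auto)
  have prod: "(\<Prod>v\<in>X. g v) \<in> A" if "\<And>v. v \<in> X \<Longrightarrow> g v \<in> A" for X and g :: "'v \<Rightarrow> _"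
    using that by (induction X rule: infinite_finite_induct) (use A1 mult in auto)
  have sum: "(\<Sum>v\<in>X. g v) \<in> A" if "\<And>v. v \<in> X \<Longrightarrow> g v \<in> A" for X and g :: "('v \<Rightarrow> nat) \<Rightarrow> _"
    using that by (induction X rule: infinite_finite_induct) (use A1 add in auto)
  have B: "B i v \<in> A" for i v
    unfolding B_def using const[of "of_nat (m choose i)"]
    by (intro mult power u) (simp add: mconst_of_nat)
  have "msubst u f = (\<Sum>\<alpha>\<in>?K. mconst (?a \<alpha>) * (\<Prod>v\<in>UNIV. \<Sum>i\<le>m. mconst (c i (Poly_Mapping.lookup \<alpha> v)) * B i v))"
    unfolding msubst_def monom_eval_UNIV B_def c_def
    by (intro sum.cong refl arg_cong2[of _ _ _ _ "(*)"] prod.cong power_eq_bernstein_sum Dm)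
  \<comment> \<open>Expanding the product over the variables turns a choice of one index per
    variable into a grid point \<iota>. Swapping the sums then collects the Bernstein coefficient
    \<open>b\<close> at \<iota>.\<close>
  also have "\<dots> = (\<Sum>\<alpha>\<in>?K. \<Sum>\<iota>\<in>?I. mconst (?a \<alpha> * (\<Prod>v\<in>UNIV. c (\<iota> v) (Poly_Mapping.lookup \<alpha> v))) * (\<Prod>v\<in>UNIV. B (\<iota> v) v))"
    by (subst prod_sum_PiE)
      (simp_all only: finite finite_atMost prod.distrib sum_distrib_left msubst.hom_mult mconst_prod mult.assoc)
  also have "\<dots> = (\<Sum>\<iota>\<in>?I. mconst (b \<iota>) * (\<Prod>v\<in>UNIV. B (\<iota> v) v))"
  proof (subst sum.swap, rule sum.cong[OF refl])
    have mconst_sum: "mconst (\<Sum>\<alpha>\<in>X. g \<alpha>) = (\<Sum>\<alpha>\<in>X. mconst (g \<alpha>))" for X and g :: "('v \<Rightarrow>\<^sub>0 nat) \<Rightarrow> real"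
      by (induction X rule: infinite_finite_induct) (simp_all add: mconst_hom)
    show "(\<Sum>\<alpha>\<in>?K. mconst (?a \<alpha> * (\<Prod>v\<in>UNIV. c (\<iota> v) (Poly_Mapping.lookup \<alpha> v))) * (\<Prod>v\<in>UNIV. B (\<iota> v) v)) =
        mconst (b \<iota>) * (\<Prod>v\<in>UNIV. B (\<iota> v) v)" for \<iota>
      by (simp add: b_def mconst_sum sum_distrib_right)
  qed
  also have "\<dots> \<in> A"
  proof (intro sum mult const prod B)
    fix \<iota> assume \<iota>: "\<iota> \<in> ?I"
    let ?x = "\<lambda>v. real (\<iota> v) / real m"
    have c: "\<bar>(\<Prod>v\<in>UNIV. c (\<iota> v) (Poly_Mapping.lookup \<alpha> v)) - (\<Prod>v\<in>UNIV. ?x v ^ Poly_Mapping.lookup \<alpha> v)\<bar>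
        \<le> real CARD('v) * (real D)\<^sup>2 / (real m - real D)" if \<alpha>: "\<alpha> \<in> ?K" for \<alpha>
    proof -
      have "\<bar>c (\<iota> v) (Poly_Mapping.lookup \<alpha> v)\<bar> \<le> 1" for v
        using \<iota> by (auto simp: c_def divide_le_eq_1 PiE_def Pi_def intro: binomial_right_mono)
      moreover have "\<bar>?x v ^ Poly_Mapping.lookup \<alpha> v\<bar> \<le> 1" for v
        using \<iota> by (auto simp: power_abs PiE_def Pi_def divide_le_eq_1 intro!: power_le_one)
      ultimately have "\<bar>(\<Prod>v\<in>UNIV. c (\<iota> v) (Poly_Mapping.lookup \<alpha> v)) - (\<Prod>v\<in>UNIV. ?x v ^ Poly_Mapping.lookup \<alpha> v)\<bar>
          \<le> (\<Sum>v\<in>UNIV. \<bar>c (\<iota> v) (Poly_Mapping.lookup \<alpha> v) - ?x v ^ Poly_Mapping.lookup \<alpha> v\<bar>)"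
        using norm_prod_diff[of UNIV "\<lambda>v. c (\<iota> v) (Poly_Mapping.lookup \<alpha> v)" "\<lambda>v. ?x v ^ Poly_Mapping.lookup \<alpha> v"]
        by simp
      also have "\<dots> \<le> (\<Sum>v\<in>(UNIV::'v set). (real D)\<^sup>2 / (real m - real D))"
        unfolding c_def using \<iota> D[OF \<alpha>] m(1)
        by (intro sum_mono bernstein_coefficient_bound) auto
      finally show ?thesis
        by simp
    qed
    have "\<bar>b \<iota> - meval f ?x\<bar> \<le> (\<Sum>\<alpha>\<in>?K. \<bar>?a \<alpha>\<bar> * (real CARD('v) * (real D)\<^sup>2 / (real m - real D)))"
      unfolding b_def meval_def monom_eval_UNIV sum_subtractf[symmetric] right_diff_distrib[symmetric]
      by (rule order.trans[OF sum_abs], unfold abs_mult) (intro sum_mono mult_left_mono c abs_ge_zero)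
    also have "\<dots> = R / (real m - real D)"
      by (simp only: R_def sum_distrib_right sum_divide_distrib times_divide_eq_right mult.assoc)
    also have "\<dots> < \<mu>"
      by (rule m)
    also have "\<mu> \<le> meval f ?x"
      using \<iota> by (intro \<mu>(2)) (auto simp: PiE_def Pi_def divide_le_eq_1)
    finally show "0 \<le> b \<iota>"
      by linarith
  qed
  finally show ?thesis .
qed

section \<open>Putinar's Positivstellensatz\<close>

lemma sos_in_quadratic_module: "sos s \<Longrightarrow> s \<in> quadratic_module gs"
  unfolding quadratic_module_def by (auto intro!: exI[of _ s] exI[of _ "\<lambda>_. 0"])

lemma quadratic_module_add:
  assumes "p \<in> quadratic_module gs" "q \<in> quadratic_module gs"
  shows "p + q \<in> quadratic_module gs"
proof -
  obtain s t \<sigma> \<tau> where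
    "p = s + (\<Sum>j<length gs. \<sigma> j * gs ! j)" "q = t + (\<Sum>j<length gs. \<tau> j * gs ! j)"
    "sos s" "sos t" "\<forall>j<length gs. sos (\<sigma> j)" "\<forall>j<length gs. sos (\<tau> j)"
    using assms by (auto simp: quadratic_module_def)
  then show ?thesis
    unfolding quadratic_module_def
    by (auto intro!: exI[of _ "s + t"] exI[of _ "\<lambda>j. \<sigma> j + \<tau> j"] sos_add
        simp: distrib_right sum.distrib)
qed

lemma quadratic_module_sum:
  "(\<And>i. i \<in> I \<Longrightarrow> p i \<in> quadratic_module gs) \<Longrightarrow> (\<Sum>i\<in>I. p i) \<in> quadratic_module gs"
  by (induction I rule: infinite_finite_induct) (simp_all add: quadratic_module_add sos_in_quadratic_module)

lemma quadratic_module_sos_mult: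
  assumes "sos t" "p \<in> quadratic_module gs"
  shows "t * p \<in> quadratic_module gs"
proof -
  obtain s \<sigma> where "p = s + (\<Sum>j<length gs. \<sigma> j * gs ! j)" "sos s" "\<forall>j<length gs. sos (\<sigma> j)"
    using assms by (auto simp: quadratic_module_def)
  then show ?thesis
    unfolding quadratic_module_def
    by (auto intro!: exI[of _ "t * s"] exI[of _ "\<lambda>j. t * \<sigma> j"] sos_mult assms
        simp: distrib_left sum_distrib_left mult.assoc)
qed

lemma generator_in_quadratic_module:
  assumes "g \<in> set gs"
  shows "g \<in> quadratic_module gs"
proof -
  obtain i where i: "i < length gs" "g = gs ! i"
    using assms by (auto simp: in_set_conv_nth)
  have "(\<Sum>j<length gs. (if j = i then 1 else 0) * gs ! j) = g"
    using i by (simp add: if_distrib[of "\<lambda>x. x * _"] cong: if_cong)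
  then show ?thesis
    unfolding quadratic_module_def by (auto intro!: exI[of _ 0] exI[of _ "\<lambda>j. if j = i then 1 else 0"])
qed

lemma quadratic_module_singleton:
  "quadratic_module [b] = {s + t * b | s t. sos s \<and> sos t}"
proof (intro equalityI subsetI)
  fix p assume "p \<in> {s + t * b | s t. sos s \<and> sos t}"
  then obtain s t where "p = s + t * b" "sos s" "sos t"
    by blast
  then show "p \<in> quadratic_module [b]"
    unfolding quadratic_module_def by (auto intro!: exI[of _ s] exI[of _ "\<lambda>_. t"])
qed (auto simp: quadratic_module_def)

text \<open>The only product of generators that can occur is \<open>b * b\<close>, a square, so it
  is absorbed by the sum-of-squares part.\<close>

lemma quadratic_module_singleton_mult:
  assumes "p \<in> quadratic_module [b]" "q \<in> quadratic_module [b]"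
  shows "p * q \<in> quadratic_module [b]"
proof -
  obtain s t s' t' where pq: "p = s + t * b" "q = s' + t' * b" and sos: "sos s" "sos t" "sos s'" "sos t'"
    using assms by (auto simp: quadratic_module_singleton)
  have "p * q = (s * s' + (t * t') * b ^ 2) + (s * t' + t * s') * b"
    by (simp add: pq algebra_simps power2_eq_square)
  moreover have "sos (s * s' + (t * t') * b ^ 2)" "sos (s * t' + t * s')"
    using sos by (auto intro!: sos_add sos_mult)
  ultimately show ?thesis
    by (auto simp: quadratic_module_singleton)
qed

text \<open>The cube circumscribes the ball. With N = sqrt C, its faces lie in the module because
  2N(N + x_v) equals the generator plus the squares of the other variables plus (N + x_v)^2.\<close>

lemma positive_on_cube_in_ball_module:
  fixes f :: "'v::finite mpoly"
  assumes "0 < C"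
    and pos: "\<And>x. (\<And>v. \<bar>x v\<bar> \<le> sqrt C) \<Longrightarrow> 0 < meval f x"
  shows "f \<in> quadratic_module [mconst C - (\<Sum>v\<in>UNIV. mvar v ^ 2)]" (is "_ \<in> quadratic_module [?b]")
proof -
  define N where "N = sqrt C"
  have N: "N > 0" "N * N = C"
    using \<open>0 < C\<close> by (simp_all add: N_def)
  have const: "mconst r \<in> quadratic_module [?b]" if "0 \<le> r" for r
    by (intro sos_in_quadratic_module sos_mconst that)
  \<comment> \<open>Assuming only \<open>q ^ 2 = mvar v ^ 2\<close> treats the two opposite faces,
    \<open>mvar v\<close> and \<open>- mvar v\<close>, together.\<close>
  have halfspace: "mconst (1 / (2 * N)) * (mconst N + q) \<in> quadratic_module [?b]"
    if q: "q ^ 2 = mvar v ^ 2" for q v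
  proof -
    have two: "mconst (2 * N) = mconst N + (mconst N :: 'v mpoly)" and sq: "mconst C = mconst N * (mconst N :: 'v mpoly)"
      using N(2) by (simp_all flip: mconst_hom(3,4))
    have eq: "mconst (2 * N) * (mconst N + q) = ?b + (\<Sum>w\<in>UNIV - {v}. mvar w ^ 2) + (mconst N + q) ^ 2"
      using sum.remove[of UNIV v "\<lambda>v. mvar v ^ 2 :: 'v mpoly"] q
      unfolding two sq by (simp add: power2_eq_square algebra_simps)
    have "mconst (2 * N) * (mconst N + q) \<in> quadratic_module [?b]"
      unfolding eq
      by (intro quadratic_module_add sos_in_quadratic_module sos_sum sos_square generator_in_quadratic_module) simp
    then have "mconst ((1 / (2 * N)) ^ 2) * (mconst (2 * N) * (mconst N + q)) \<in> quadratic_module [?b]"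
      by (rule quadratic_module_sos_mult[OF sos_mconst, rotated]) simp
    moreover have "mconst ((1 / (2 * N)) ^ 2) * mconst (2 * N) = (mconst (1 / (2 * N)) :: 'v mpoly)"
      using N by (simp add: power2_eq_square field_simps flip: mconst_hom(4))
    ultimately show ?thesis
      by (simp add: mult.assoc[symmetric])
  qed
  \<comment> \<open>\<open>u\<close> maps [-N, N] affinely onto [0, 1] in each coordinate, and
    \<open>t\<close> is its inverse.\<close>
  define u where "u v = mconst (1 / (2 * N)) * (mconst N + mvar v)" for v :: 'v
  define t where "t v = mconst (2 * N) * mvar v - mconst N" for v :: 'v
  have inv: "mconst (2 * N) * mconst (1 / (2 * N)) = (1 :: 'v mpoly)"
    using N by (simp add: mconst_hom(2) flip: mconst_hom(4))
  have "msubst u (msubst t f) \<in> quadratic_module [?b]"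
  proof (rule positive_on_cube_in_semiring)
    show "0 < meval (msubst t f) x" if x: "\<And>v. 0 \<le> x v \<and> x v \<le> 1" for x
    proof -
      have "\<bar>2 * N * x v - N\<bar> \<le> N" for v
        using x[of v] N mult_left_mono[of "x v" 1 N] by (auto simp: abs_le_iff)
      then show ?thesis
        using pos[of "\<lambda>v. 2 * N * x v - N"] by (simp add: t_def N_def)
    qed
    show "1 - u v \<in> quadratic_module [?b]" for v
    proof -
      have "mconst (2 * N) = mconst N + (mconst N :: 'v mpoly)"
        by (simp flip: mconst_hom(3))
      then have "1 - u v = mconst (1 / (2 * N)) * (mconst N + - mvar v)"
        unfolding u_def by (subst inv[symmetric]) (simp add: algebra_simps)
      then show ?thesis
        using halfspace[of "- mvar v"] by simp
    qed
    show "u v \<in> quadratic_module [?b]" for v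
      unfolding u_def by (rule halfspace) simp
  qed (use const quadratic_module_add quadratic_module_singleton_mult in blast)+
  also have "msubst u (msubst t f) = f"
  proof -
    have "mconst (2 * N) * u v - mconst N = mvar v" for v
      unfolding u_def by (simp add: mult.assoc[symmetric] inv)
    then show ?thesis
      by (simp add: msubst.heval_msubst t_def msubst_mvar)
  qed
  finally show ?thesis .
qed

text \<open>
  The weights \<open>(1 - g)^(2 n)\<close> stay above 1 where \<open>g < 0\<close> and make the contribution of \<open>g\<close>
  negligible where \<open>g \<ge> 0\<close>.
\<close>

lemma positive_perturbation:
  fixes f :: "'a::t2_space \<Rightarrow> real" and g :: "'i \<Rightarrow> 'a \<Rightarrow> real"
  assumes "compact X" "finite I" and f: "continuous_on X f"
    and g: "\<And>i. i \<in> I \<Longrightarrow> continuous_on X (g i)"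
    and le1: "\<And>i x. i \<in> I \<Longrightarrow> x \<in> X \<Longrightarrow> g i x \<le> 1"
    and pos: "\<And>x. x \<in> X \<Longrightarrow> (\<And>i. i \<in> I \<Longrightarrow> 0 \<le> g i x) \<Longrightarrow> 0 < f x"
  shows "\<exists>r\<ge>0. \<exists>n. \<forall>x\<in>X. 0 < f x - r * (\<Sum>i\<in>I. (1 - g i x) ^ (2 * n) * g i x)"
proof (cases "X = {}")
  case False
  \<comment> \<open>A penalty for violated constraints: it vanishes exactly where all
    \<open>g i\<close> are nonnegative. A multiple of it repairs the sign of \<open>f\<close> first;
    the smooth weights imitate it afterwards.\<close>
  define G where "G x = (\<Sum>i\<in>I. max 0 (- g i x))" for x
  have G: "continuous_on X G"
    unfolding G_def by (intro continuous_intros g) auto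
  have "\<exists>r\<ge>0. \<forall>x\<in>X. 0 < f x + r * G x"
  proof (cases "\<exists>x\<in>X. f x \<le> 0")
    case True
    let ?A = "{x \<in> X. f x \<le> 0}"
    have "?A = X \<inter> f -` {..0}"
      by auto
    then have A: "compact ?A" "?A \<noteq> {}"
      using True closedin_compact[OF \<open>compact X\<close> continuous_closedin_preimage[OF f, of "{..0}"]]
      by auto
    obtain y where y: "y \<in> ?A" "\<forall>x\<in>?A. G y \<le> G x"
      using continuous_attains_inf[OF A continuous_on_subset[OF G]] by auto
    obtain z where z: "\<forall>x\<in>?A. f z \<le> f x"
      using continuous_attains_inf[OF A continuous_on_subset[OF f]] by auto
    note yz = y(1) y(2)[rule_format] z[rule_format]
    have "0 < G y"
    proof -
      obtain i where "i \<in> I" "g i y < 0"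
        using pos[of y] yz(1) by force
      then have "0 < max 0 (- g i y)" by simp
      also have "\<dots> \<le> G y"
        unfolding G_def using \<open>i \<in> I\<close> \<open>finite I\<close> by (intro member_le_sum) auto
      finally show ?thesis .
    qed
    show ?thesis
    proof (intro exI conjI ballI)
      \<comment> \<open>On the compact set where \<open>f\<close> is nonpositive, \<open>f\<close>
        is at least \<open>f z\<close> and \<open>G\<close> at least \<open>G y > 0\<close>, so this
        multiple lifts the sum to at least 1 there.\<close>
      let ?r = "(\<bar>f z\<bar> + 1) / G y"
      show "0 \<le> ?r"
        using \<open>0 < G y\<close> by simp
      fix x assume "x \<in> X"
      show "0 < f x + ?r * G x"
      proof (cases "f x \<le> 0")
        case True
        then have "\<bar>f z\<bar> + 1 \<le> ?r * G x"
          using yz(2)[of x] \<open>x \<in> X\<close> \<open>0 < G y\<close> mult_left_mono[of "G y" "G x" ?r] by simp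
        moreover have "- \<bar>f z\<bar> \<le> f x"
          using yz(3)[of x] True \<open>x \<in> X\<close> by simp
        ultimately show ?thesis
          by linarith
      next
        case False
        moreover have "0 \<le> ?r * G x"
          by (intro mult_nonneg_nonneg \<open>0 \<le> ?r\<close>) (simp add: G_def sum_nonneg)
        ultimately show ?thesis
          by linarith
      qed
    qed
  qed (auto intro!: exI[of _ 0] simp: not_le)
  then obtain r where r: "0 \<le> r" "\<And>x. x \<in> X \<Longrightarrow> 0 < f x + r * G x"
    by blast
  have "continuous_on X (\<lambda>x. f x + r * G x)"
    by (intro continuous_intros f G)
  then obtain y where y: "y \<in> X" "\<And>x. x \<in> X \<Longrightarrow> f y + r * G y \<le> f x + r * G x"
    using continuous_attains_inf[OF \<open>compact X\<close> False, of "\<lambda>x. f x + r * G x"] by auto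
  \<comment> \<open>The margin left by the exact penalty; \<open>n\<close> is chosen so that
    replacing the penalty by the weighted sum costs less.\<close>
  define \<epsilon> where "\<epsilon> = f y + r * G y"
  have "0 < \<epsilon>"
    using r y by (simp add: \<epsilon>_def)
  obtain n where n: "r * real (card I) / \<epsilon> < real n"
    using reals_Archimedean2 by blast
  then have "0 < n"
    using mult_nonneg_nonneg[OF r(1), of "real (card I)"] \<open>0 < \<epsilon>\<close> by (cases n) (auto simp: field_simps)
  \<comment> \<open>For 0 \<le> t \<le> 1, Bernoulli's inequality gives (1 - t)^n (1 + nt) \<le> (1
    - t^2)^n \<le> 1, hence (1 - t)^n t \<le> 1/n. For t < 0 the weight is at least 1.\<close>
  have weight: "(1 - t) ^ (2 * n) * t \<le> 1 / n - max 0 (- t)" if "t \<le> 1" for t :: real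
  proof (cases "0 \<le> t")
    case True
    have "(1 - t) ^ n * (1 + real n * t) \<le> (1 - t) ^ n * (1 + t) ^ n"
      using True that by (intro mult_left_mono Bernoulli_inequality) auto
    also have "\<dots> = (1 - t ^ 2) ^ n"
      by (simp add: power_mult_distrib[symmetric] power2_eq_square algebra_simps)
    also have "\<dots> \<le> 1"
      using True that by (intro power_le_one) (auto simp: power_le_one)
    finally have "(1 - t) ^ n + n * ((1 - t) ^ n * t) \<le> 1"
      by (simp add: algebra_simps)
    moreover have "0 \<le> (1 - t) ^ n"
      using that by simp
    ultimately have "n * ((1 - t) ^ n * t) \<le> 1"
      by linarith
    then have "(1 - t) ^ n * t \<le> 1 / n"
      using \<open>0 < n\<close> by (simp add: pos_le_divide_eq mult.commute)
    moreover have "(1 - t) ^ (2 * n) * t \<le> (1 - t) ^ n * t"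
      using True that by (intro mult_right_mono power_decreasing) auto
    ultimately show ?thesis
      using True by simp
  next
    case False
    then have "(1 - t) ^ (2 * n) * t \<le> 1 * t"
      by (intro mult_right_mono_neg one_le_power) auto
    moreover have "max 0 (- t) = - t" "0 \<le> 1 / real n"
      using False by auto
    ultimately show ?thesis
      by linarith
  qed
  show ?thesis
  proof (intro exI conjI ballI)
    fix x assume "x \<in> X"
    have "(\<Sum>i\<in>I. (1 - g i x) ^ (2 * n) * g i x) \<le> (\<Sum>i\<in>I. 1 / n - max 0 (- g i x))"
      by (intro sum_mono weight le1 \<open>x \<in> X\<close>)
    also have "\<dots> = card I / n - G x"
      by (simp add: G_def sum_subtractf)
    finally have "r * (\<Sum>i\<in>I. (1 - g i x) ^ (2 * n) * g i x) \<le> r * (card I / n - G x)"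
      using r(1) by (rule mult_left_mono)
    then have "r * (\<Sum>i\<in>I. (1 - g i x) ^ (2 * n) * g i x) \<le> r * card I / n - r * G x"
      by (simp add: right_diff_distrib)
    moreover have "r * card I / n < \<epsilon>"
      using n \<open>0 < n\<close> \<open>0 < \<epsilon>\<close> by (simp add: field_simps)
    moreover have "\<epsilon> \<le> f x + r * G x"
      using y \<open>x \<in> X\<close> by (simp add: \<epsilon>_def)
    ultimately show "0 < f x - r * (\<Sum>i\<in>I. (1 - g i x) ^ (2 * n) * g i x)"
      by linarith
  qed (rule r)
qed auto

theorem putinar:
  fixes f :: "'v::finite mpoly"
  assumes "archimedean (quadratic_module gs)"
    and pos: "\<And>x. (\<And>g. g \<in> set gs \<Longrightarrow> 0 \<le> meval g x) \<Longrightarrow> 0 < meval f x"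
  shows "f \<in> quadratic_module gs"
proof -
  obtain C where "0 < C" and C: "mconst C - (\<Sum>v\<in>UNIV. mvar v ^ 2) \<in> quadratic_module gs" (is "?b \<in> _")
    using assms(1) by (auto simp: archimedean_def)
  define X :: "(real ^ 'v) set" where "X = cbox (\<chi> v. - sqrt C) (\<chi> v. sqrt C)"
  have "compact X"
    by (simp add: X_def)
  obtain B where "0 < B" and B: "\<And>g x. g \<in> set gs \<Longrightarrow> x \<in> X \<Longrightarrow> peval g x \<le> B"
  proof -
    have "\<exists>B. \<forall>x\<in>X. peval g x \<le> B" for g
      using compact_imp_bounded[OF compact_continuous_image[OF continuous_on_peval \<open>compact X\<close>]]
      by (force simp: bounded_iff abs_le_iff)
    then obtain B where B: "\<And>g x. x \<in> X \<Longrightarrow> peval g x \<le> B g"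
      by metis
    show thesis
    proof (rule that[of "1 + (\<Sum>g\<in>set gs. \<bar>B g\<bar>)"])
      show "peval g x \<le> 1 + (\<Sum>g\<in>set gs. \<bar>B g\<bar>)" if "g \<in> set gs" "x \<in> X" for g x
        using B[OF that(2), of g] member_le_sum[of g "set gs" "\<lambda>g. \<bar>B g\<bar>"] that(1) by fastforce
    qed (simp add: add_pos_nonneg sum_nonneg)
  qed
  let ?g = "\<lambda>i x. peval (gs ! i) x / B"
  have "\<exists>r\<ge>0. \<exists>n. \<forall>x\<in>X. 0 < peval f x - r * (\<Sum>i<length gs. (1 - ?g i x) ^ (2 * n) * ?g i x)"
  proof (rule positive_perturbation)
    show "?g i x \<le> 1" if "i \<in> {..<length gs}" "x \<in> X" for i x
      using B[of "gs ! i" x] \<open>0 < B\<close> that by simp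
    show "0 < peval f x" if "\<And>i. i \<in> {..<length gs} \<Longrightarrow> 0 \<le> ?g i x" for x
      unfolding peval_def
    proof (rule pos)
      fix g assume "g \<in> set gs"
      then show "0 \<le> meval g (($) x)"
        using that \<open>0 < B\<close> by (auto simp: in_set_conv_nth zero_le_divide_iff peval_def)
    qed
  qed (use \<open>compact X\<close> \<open>0 < B\<close> in \<open>auto intro!: continuous_intros continuous_on_peval\<close>)
  then obtain r n where "0 \<le> r"
    and r: "\<And>x. x \<in> X \<Longrightarrow> 0 < peval f x - r * (\<Sum>i<length gs. (1 - ?g i x) ^ (2 * n) * ?g i x)"
    by blast
  \<comment> \<open>The factor \<open>1 / B\<close> of the scaled generator moves into the constant,
    and the even power is written as a square to make the multiplier a sum of squares.\<close>
  define s where "s i = mconst (r / B) * ((1 - mconst (1 / B) * gs ! i) ^ n) ^ 2" for i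
  define F where "F = f - (\<Sum>i<length gs. s i * gs ! i)"
  have "F \<in> quadratic_module [?b]"
  proof (rule positive_on_cube_in_ball_module[OF \<open>0 < C\<close>])
    fix x :: "'v \<Rightarrow> real" assume "\<And>v. \<bar>x v\<bar> \<le> sqrt C"
    then have "(\<chi> v. x v) \<in> X"
      by (auto simp: X_def mem_box_cart abs_le_iff minus_le_iff)
    from r[OF this] show "0 < meval F x"
      by (simp add: F_def s_def peval_def sum_distrib_left power_mult[symmetric] mult_ac)
  qed
  then have "F \<in> quadratic_module gs"
    unfolding quadratic_module_singleton
    using quadratic_module_add[OF sos_in_quadratic_module quadratic_module_sos_mult[OF _ C]] by blast
  moreover have "(\<Sum>i<length gs. s i * gs ! i) \<in> quadratic_module gs"
    unfolding s_def using \<open>0 \<le> r\<close> \<open>0 < B\<close>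
    by (intro quadratic_module_sum quadratic_module_sos_mult sos_mult sos_mconst sos_square
        generator_in_quadratic_module) auto
  ultimately have "F + (\<Sum>i<length gs. s i * gs ! i) \<in> quadratic_module gs"
    by (rule quadratic_module_add)
  then show ?thesis
    by (simp add: F_def)
qed

section \<open>Upper semicontinuous functions\<close>

lemma set_integrable_lebesgue_compact:
  fixes f :: "'a::euclidean_space \<Rightarrow> real"
  assumes "compact C" "continuous_on C f"
  shows "set_integrable lebesgue C f"
  using borel_integrable_compact[OF assms] unfolding set_integrable_def
  by (simp add: integrable_completion borel_measurable_integrable)

text \<open>The sup-convolution, or Pasch-Hausdorff envelope: the supremum over b of J(b) - n
  dist(a, b) is n-Lipschitz in a, and upper semicontinuity makes it tend to J(a).\<close>

lemma sup_convolution: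
  fixes J :: "'a::euclidean_space \<Rightarrow> real"
  assumes "C \<noteq> {}" and bounds: "\<And>a. a \<in> C \<Longrightarrow> lo \<le> J a \<and> J a \<le> hi"
    and usc: "\<And>a t. a \<in> C \<Longrightarrow> J a < t \<Longrightarrow> \<exists>\<delta>>0. \<forall>b\<in>C. dist a b < \<delta> \<longrightarrow> J b \<le> t"
  obtains \<phi> :: "nat \<Rightarrow> 'a \<Rightarrow> real" where
    "\<And>n. continuous_on UNIV (\<phi> n)"
    "\<And>n a. a \<in> C \<Longrightarrow> J a \<le> \<phi> n a \<and> \<phi> n a \<le> hi"
    "\<And>a. a \<in> C \<Longrightarrow> (\<lambda>n. \<phi> n a) \<longlonglongrightarrow> J a"
proof -
  define \<phi> where "\<phi> n a = (SUP b\<in>C. J b - real n * dist a b)" for n a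
  have le_hi: "J b - real n * dist a b \<le> hi" if "b \<in> C" for n a b
  proof -
    have "0 \<le> real n * dist a b" by simp
    then show ?thesis
      using bounds[OF that] by linarith
  qed
  have bdd: "bdd_above ((\<lambda>b. J b - real n * dist a b) ` C)" for n a
    using le_hi by (intro bdd_aboveI2)
  have le_\<phi>: "J b - real n * dist a b \<le> \<phi> n a" if "b \<in> C" for n a b
    unfolding \<phi>_def by (rule cSUP_upper[OF that bdd])
  have \<phi>_le: "\<phi> n a \<le> t" if "\<And>b. b \<in> C \<Longrightarrow> J b - real n * dist a b \<le> t" for n a t
    unfolding \<phi>_def using \<open>C \<noteq> {}\<close> that by (rule cSUP_least)
  have step: "\<phi> n a \<le> \<phi> n a' + real n * dist a a'" for n a a'
  proof (rule \<phi>_le)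
    fix b assume "b \<in> C"
    have "real n * dist a' b \<le> real n * (dist a a' + dist a b)"
      by (intro mult_left_mono) (auto intro: dist_triangle3)
    then show "J b - real n * dist a b \<le> \<phi> n a' + real n * dist a a'"
      using le_\<phi>[OF \<open>b \<in> C\<close>, of n a'] by (simp add: algebra_simps)
  qed
  have "(real n)-lipschitz_on UNIV (\<phi> n)" for n
  proof (rule lipschitz_onI)
    show "dist (\<phi> n x) (\<phi> n y) \<le> real n * dist x y" for x y
      using step[of n x y] step[of n y x] by (simp add: dist_real_def abs_le_iff dist_commute)
  qed simp
  then have cont: "continuous_on UNIV (\<phi> n)" for n
    by (rule lipschitz_on_continuous_on)
  have lower: "J a \<le> \<phi> n a" if "a \<in> C" for n a
    using le_\<phi>[OF that, of n a] by simp
  have lim: "(\<lambda>n. \<phi> n a) \<longlonglongrightarrow> J a" if a: "a \<in> C" for a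
  proof (rule LIMSEQ_I)
    fix r :: real assume "0 < r"
    then obtain \<delta> where \<delta>: "0 < \<delta>" "\<And>b. b \<in> C \<Longrightarrow> dist a b < \<delta> \<Longrightarrow> J b \<le> J a + r / 2"
      using usc[OF a, of "J a + r / 2"] by auto
    \<comment> \<open>Beyond distance \<delta> the penalty n \<delta> exceeds the oscillation
      \<open>hi - lo\<close>, so only points near \<open>a\<close> can push the supremum above
      \<open>J a\<close>.\<close>
    obtain n0 where n0: "(hi - lo) / \<delta> < real n0"
      using reals_Archimedean2 by blast
    have "norm (\<phi> n a - J a) < r" if "n0 \<le> n" for n
    proof -
      have "\<phi> n a \<le> J a + r / 2"
      proof (rule \<phi>_le)
        fix b assume b: "b \<in> C"
        show "J b - real n * dist a b \<le> J a + r / 2"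
        proof (cases "dist a b < \<delta>")
          case True
          have "0 \<le> real n * dist a b" by simp
          then show ?thesis
            using \<delta>(2)[OF b True] by linarith
        next
          case False
          have "hi - lo \<le> real n0 * \<delta>"
            using n0 \<open>0 < \<delta>\<close> by (simp add: field_simps)
          also have "\<dots> \<le> real n * dist a b"
            using False \<open>0 < \<delta>\<close> that by (intro mult_mono) auto
          finally show ?thesis
            using bounds[OF a] bounds[OF b] \<open>0 < r\<close> by linarith
        qed
      qed
      then show ?thesis
        using lower[OF a, of n] \<open>0 < r\<close> by simp
    qed
    then show "\<exists>n0. \<forall>n\<ge>n0. norm (\<phi> n a - J a) < r"
      by blast
  qed
  show thesis
    by (rule that[of \<phi>]) (use cont lower lim \<phi>_le le_hi in auto)
qed

text \<open>Measurability of \<open>J\<close> is a result here, obtained from the pointwise limit of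
  its sup-convolutions. The uniform bounds then allow dominated convergence.\<close>

lemma usc_upper_approximation:
  fixes J :: "'a::euclidean_space \<Rightarrow> real"
  assumes "compact C" and bounds: "\<And>a. a \<in> C \<Longrightarrow> lo \<le> J a \<and> J a \<le> hi"
    and usc: "\<And>a t. a \<in> C \<Longrightarrow> J a < t \<Longrightarrow> \<exists>\<delta>>0. \<forall>b\<in>C. dist a b < \<delta> \<longrightarrow> J b \<le> t"
  shows "set_integrable lebesgue C J"
    and "0 < \<epsilon> \<Longrightarrow> \<exists>\<phi>. continuous_on C \<phi> \<and> (\<forall>a\<in>C. J a \<le> \<phi> a) \<and>
      (LINT a:C|lebesgue. \<phi> a) < (LINT a:C|lebesgue. J a) + \<epsilon>"
proof -
  have "set_integrable lebesgue C J \<and> (0 < \<epsilon> \<longrightarrow> (\<exists>\<phi>. continuous_on C \<phi> \<and> (\<forall>a\<in>C. J a \<le> \<phi> a) \<and>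
      (LINT a:C|lebesgue. \<phi> a) < (LINT a:C|lebesgue. J a) + \<epsilon>))"
  proof (cases "C = {}")
    case True
    then show ?thesis
      by (simp add: set_integrable_def set_lebesgue_integral_def)
  next
    case False
    obtain \<phi> :: "nat \<Rightarrow> 'a \<Rightarrow> real" where cont: "\<And>n. continuous_on UNIV (\<phi> n)"
      and \<phi>: "\<And>n a. a \<in> C \<Longrightarrow> J a \<le> \<phi> n a \<and> \<phi> n a \<le> hi"
      and lim: "\<And>a. a \<in> C \<Longrightarrow> (\<lambda>n. \<phi> n a) \<longlonglongrightarrow> J a"
      using sup_convolution[OF False bounds usc] by metis
    have C: "C \<in> sets lebesgue"
      using \<open>compact C\<close> by (simp add: borel_compact)
    let ?B = "\<bar>lo\<bar> + \<bar>hi\<bar>"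
    have meas: "(\<lambda>a. indicator C a *\<^sub>R \<phi> n a) \<in> borel_measurable lebesgue" for n
      using set_integrable_lebesgue_compact[OF \<open>compact C\<close> continuous_on_subset[OF cont]]
      by (simp add: set_integrable_def borel_measurable_integrable)
    have lim': "(\<lambda>n. indicator C a *\<^sub>R \<phi> n a) \<longlonglongrightarrow> indicator C a *\<^sub>R J a" for a
      using lim by (cases "a \<in> C") auto
    have measJ: "(\<lambda>a. indicator C a *\<^sub>R J a) \<in> borel_measurable lebesgue"
      by (rule borel_measurable_LIMSEQ_real[OF lim' meas])
    have dominated: "integrable lebesgue (\<lambda>a. indicator C a *\<^sub>R ?B)"
      using set_integrable_lebesgue_compact[OF \<open>compact C\<close>, of "\<lambda>_. ?B"] by (simp add: set_integrable_def)
    have bound: "norm (indicator C a *\<^sub>R \<phi> n a) \<le> indicator C a *\<^sub>R ?B" for n a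
      using bounds[of a] \<phi>[of a n] by (cases "a \<in> C") auto
    have "integrable lebesgue (\<lambda>a. indicator C a *\<^sub>R J a)"
      by (rule integrable_dominated_convergence[OF measJ meas dominated AE_I2[OF lim'] AE_I2[OF bound]])
    moreover have conv: "(\<lambda>n. LINT a:C|lebesgue. \<phi> n a) \<longlonglongrightarrow> (LINT a:C|lebesgue. J a)"
      unfolding set_lebesgue_integral_def
      by (rule integral_dominated_convergence[OF measJ meas dominated AE_I2[OF lim'] AE_I2[OF bound]])
    moreover have "\<exists>\<phi>. continuous_on C \<phi> \<and> (\<forall>a\<in>C. J a \<le> \<phi> a) \<and>
      (LINT a:C|lebesgue. \<phi> a) < (LINT a:C|lebesgue. J a) + \<epsilon>" if "0 < \<epsilon>"
    proof -
      have "\<forall>\<^sub>F n in sequentially. (LINT a:C|lebesgue. \<phi> n a) < (LINT a:C|lebesgue. J a) + \<epsilon>"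
        using conv by (rule order_tendstoD) (use that in simp)
      then obtain n where "(LINT a:C|lebesgue. \<phi> n a) < (LINT a:C|lebesgue. J a) + \<epsilon>"
        by (meson eventually_happens sequentially_bot)
      then show ?thesis
        using \<phi> continuous_on_subset[OF cont] by blast
    qed
    ultimately show ?thesis
      by (simp add: set_integrable_def)
  qed
  then show "set_integrable lebesgue C J"
    and "0 < \<epsilon> \<Longrightarrow> \<exists>\<phi>. continuous_on C \<phi> \<and> (\<forall>a\<in>C. J a \<le> \<phi> a) \<and>
      (LINT a:C|lebesgue. \<phi> a) < (LINT a:C|lebesgue. J a) + \<epsilon>"
    by blast+
qed

text \<open>Turns the polynomial functions delivered by Stone-Weierstrass into formal polynomials,
  whose coefficients are the variables of the programs.\<close>

lemma real_polynomial_function_eq_peval: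
  fixes f :: "real ^ 'm::finite \<Rightarrow> real"
  assumes "real_polynomial_function f"
  shows "\<exists>p. f = peval p"
  using assms
proof induction
  case (linear f)
  then interpret bounded_linear f .
  have "f x = peval (\<Sum>j\<in>UNIV. mconst (f (axis j 1)) * mvar j) x" for x
  proof -
    have "f x = f (\<Sum>j\<in>UNIV. x $ j *\<^sub>R axis j 1)"
      using basis_expansion[of x] by (simp add: scalar_mult_eq_scaleR)
    then show ?thesis
      by (simp add: peval_def sum scaleR mult.commute)
  qed
  then show ?case
    by blast
next
  case (const c)
  have "peval (mconst c) x = c" for x :: "real ^ 'm"
    by (simp add: peval_def)
  then show ?case
    by metis
next
  case (add f g)
  then obtain p q where "f = peval p" "g = peval q"
    by blast
  then show ?case
    by (intro exI[of _ "p + q"]) (simp add: peval_def fun_eq_iff)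
next
  case (mult f g)
  then obtain p q where "f = peval p" "g = peval q"
    by blast
  then show ?case
    by (intro exI[of _ "p * q"]) (simp add: peval_def fun_eq_iff)
qed

text \<open>Approximating \<phi> + \<eta> to within \<eta> puts the polynomial strictly above
  \<phi>, at a cost of at most 2 \<eta> per unit of measure.\<close>

lemma usc_polynomial_upper_approximation:
  fixes J :: "real ^ 'm::finite \<Rightarrow> real"
  assumes C: "compact C" and bounds: "\<And>a. a \<in> C \<Longrightarrow> lo \<le> J a \<and> J a \<le> hi"
    and usc: "\<And>a t. a \<in> C \<Longrightarrow> J a < t \<Longrightarrow> \<exists>\<delta>>0. \<forall>b\<in>C. dist a b < \<delta> \<longrightarrow> J b \<le> t"
    and "0 < \<epsilon>"
  shows "\<exists>p. (\<forall>a\<in>C. J a < peval p a) \<and> (LINT a:C|lebesgue. peval p a) \<le> (LINT a:C|lebesgue. J a) + \<epsilon>"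
proof -
  obtain \<phi> where \<phi>: "continuous_on C \<phi>" "\<And>a. a \<in> C \<Longrightarrow> J a \<le> \<phi> a"
      "(LINT a:C|lebesgue. \<phi> a) < (LINT a:C|lebesgue. J a) + \<epsilon> / 2"
    using usc_upper_approximation(2)[OF C bounds usc, of "\<epsilon> / 2"] \<open>0 < \<epsilon>\<close> by auto
  \<comment> \<open>The summand 1 keeps the denominator positive when \<open>C\<close> is a null
    set.\<close>
  define \<eta> where "\<eta> = \<epsilon> / (4 * (measure lebesgue C + 1))"
  have \<eta>: "0 < \<eta>" "2 * \<eta> * measure lebesgue C \<le> \<epsilon> / 2"
  proof -
    have pos: "0 < measure lebesgue C + 1"
      by (simp add: add_nonneg_pos)
    then show "0 < \<eta>"
      using \<open>0 < \<epsilon>\<close> by (simp add: \<eta>_def)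
    show "2 * \<eta> * measure lebesgue C \<le> \<epsilon> / 2"
      using pos \<open>0 < \<epsilon>\<close> by (simp add: \<eta>_def field_simps)
  qed
  obtain g where g: "real_polynomial_function g" "\<And>a. a \<in> C \<Longrightarrow> \<bar>\<phi> a + \<eta> - g a\<bar> < \<eta>"
    using Stone_Weierstrass_real_polynomial_function[OF C continuous_on_add[OF \<phi>(1) continuous_on_const] \<eta>(1)]
    by blast
  obtain p where p: "g = peval p"
    using real_polynomial_function_eq_peval[OF g(1)] by blast
  have C_fin: "C \<in> sets lebesgue" "emeasure lebesgue C < \<infinity>"
    using C emeasure_compact_finite[OF C] by (auto simp: borel_compact less_top)
  have const: "set_integrable lebesgue C (\<lambda>_. 2 * \<eta>)"
    by (rule set_integrable_lebesgue_compact[OF C]) simp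
  have "(LINT a:C|lebesgue. peval p a) \<le> (LINT a:C|lebesgue. \<phi> a + 2 * \<eta>)"
    using g(2) p
    by (intro set_integral_mono set_integrable_lebesgue_compact C continuous_on_peval continuous_intros \<phi>(1))
      (auto simp: abs_less_iff algebra_simps less_imp_le)
  also have "\<dots> = (LINT a:C|lebesgue. \<phi> a) + 2 * \<eta> * measure lebesgue C"
    using set_integral_add(2)[OF set_integrable_lebesgue_compact[OF C \<phi>(1)] const]
      set_integral_const[of C lebesgue "2 * \<eta>"] C_fin by (simp add: mult.commute)
  also have "\<dots> \<le> (LINT a:C|lebesgue. J a) + \<epsilon>"
    using \<phi>(3) \<eta>(2) by linarith
  finally show ?thesis
    using \<phi>(2) g(2) p by (intro exI[of _ p]) (force simp: abs_less_iff)
qed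

section \<open>The value function of a verification condition\<close>

text \<open>All later arguments treat the value function through its upper bounds, so an empty K(a)
  needs no case distinction: only the cutoff condition remains.\<close>

lemma Jfun_le_iff:
  "Jfun M hx gs l a \<le> ereal t \<longleftrightarrow> - M \<le> t \<and> (\<forall>x\<in>Kset hx gs a. peval2 l a x \<le> t)"
  by (auto simp: Jfun_def Jbar_def SUP_le_iff)

lemma Jfun_bounded:
  fixes hx :: "'n::finite mpoly list" and l :: "('m::finite + 'n) mpoly"
  assumes "compact (basic_set hx)" "compact C"
  obtains B where "\<And>a. a \<in> C \<Longrightarrow> Jfun M hx gs l a \<le> ereal B"
proof -
  have "compact ((\<lambda>(a, x). peval2 l a x) ` (C \<times> basic_set hx))"
    by (intro compact_continuous_image continuous_on_peval2 compact_Times assms)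
  then obtain B where B: "\<And>a x. a \<in> C \<Longrightarrow> x \<in> basic_set hx \<Longrightarrow> \<bar>peval2 l a x\<bar> \<le> B"
    by (force dest!: compact_imp_bounded simp: bounded_iff)
  show thesis
  proof (rule that[of "max (- M) B"])
    show "Jfun M hx gs l a \<le> ereal (max (- M) B)" if "a \<in> C" for a
      unfolding Jfun_le_iff using B[OF that] by (force simp: Kset_def)
  qed
qed

text \<open>Integration needs a real function. The cutoff at \<open>- M\<close> and compactness of
  the state set keep the extended value finite, so the default value of \<open>real_of_ereal\<close>
  at infinity never enters.\<close>

definition Jreal ::
    "real \<Rightarrow> 'n::finite mpoly list \<Rightarrow> ('m + 'n) mpoly list \<Rightarrow> ('m + 'n) mpoly \<Rightarrow> real ^ 'm \<Rightarrow> real" where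
  "Jreal M hx gs l a = real_of_ereal (Jfun M hx gs l a)"

lemma ereal_Jreal:
  fixes hx :: "'n::finite mpoly list" and l :: "('m::finite + 'n) mpoly"
  assumes "compact (basic_set hx)"
  shows "ereal (Jreal M hx gs l a) = Jfun M hx gs l a"
proof -
  obtain B where "Jfun M hx gs l a \<le> ereal B"
    using Jfun_bounded[OF assms, of "{a}"] by (metis compact_sing singletonI)
  moreover have "ereal (- M) \<le> Jfun M hx gs l a"
    by (simp add: Jfun_def)
  ultimately have "\<bar>Jfun M hx gs l a\<bar> \<noteq> \<infinity>"
    by (cases "Jfun M hx gs l a") auto
  then show ?thesis
    by (simp add: Jreal_def ereal_real)
qed

lemma Jreal_le_iff:
  fixes hx :: "'n::finite mpoly list" and l :: "('m::finite + 'n) mpoly"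
  assumes "compact (basic_set hx)"
  shows "Jreal M hx gs l a \<le> t \<longleftrightarrow> - M \<le> t \<and> (\<forall>x\<in>Kset hx gs a. peval2 l a x \<le> t)"
  using Jfun_le_iff[of M hx gs l a t] by (simp flip: ereal_Jreal[OF assms])

text \<open>The parameters admitting a feasible state with target at least \<open>t\<close> form the
  projection of a compact set, hence a closed set. It misses \<open>a\<close>, and so a whole ball
  around \<open>a\<close>.\<close>

lemma Jreal_usc:
  fixes hx :: "'n::finite mpoly list" and l :: "('m::finite + 'n) mpoly"
  assumes X: "compact (basic_set hx)" and C: "compact C" and "a \<in> C" "Jreal M hx gs l a < t"
  shows "\<exists>\<delta>>0. \<forall>b\<in>C. dist a b < \<delta> \<longrightarrow> Jreal M hx gs l b \<le> t"
proof -
  define S where "S = {z \<in> C \<times> basic_set hx.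
    (\<forall>g\<in>set gs. peval2 g (fst z) (snd z) \<le> 0) \<and> t \<le> peval2 l (fst z) (snd z)}"
  have peval2: "continuous_on UNIV (\<lambda>z. peval2 q (fst z) (snd z))" for q :: "('m + 'n) mpoly"
    using continuous_on_peval2[of UNIV q] by (simp add: case_prod_beta)
  have "S = (C \<times> basic_set hx) \<inter> ((\<Inter>g\<in>set gs. {z. peval2 g (fst z) (snd z) \<le> 0}) \<inter> {z. t \<le> peval2 l (fst z) (snd z)})"
    by (auto simp: S_def)
  moreover have "closed ((\<Inter>g\<in>set gs. {z. peval2 g (fst z) (snd z) \<le> 0}) \<inter> {z. t \<le> peval2 l (fst z) (snd z)})"
    by (intro closed_Int closed_INT ballI closed_Collect_le peval2 continuous_on_const)
  ultimately have "compact S"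
    using compact_Int_closed[OF compact_Times[OF C X]] by simp
  then have "closed (fst ` S)"
    by (intro compact_imp_closed compact_continuous_image continuous_on_fst continuous_on_id)
  have J: "- M \<le> Jreal M hx gs l a" "\<And>x. x \<in> Kset hx gs a \<Longrightarrow> peval2 l a x \<le> Jreal M hx gs l a"
    using Jreal_le_iff[OF X, of M gs l a "Jreal M hx gs l a"] by auto
  have "a \<notin> fst ` S"
    using J(2) assms(4) by (fastforce simp: S_def Kset_def)
  then obtain \<delta> where \<delta>: "0 < \<delta>" "ball a \<delta> \<subseteq> - fst ` S"
    using \<open>closed (fst ` S)\<close> by (metis ComplI open_Compl open_contains_ball)
  have "Jreal M hx gs l b \<le> t" if "b \<in> C" "dist a b < \<delta>" for b
    unfolding Jreal_le_iff[OF X]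
  proof (intro conjI ballI)
    fix x assume "x \<in> Kset hx gs b"
    then have "(b, x) \<in> S" if "t \<le> peval2 l b x"
      using that \<open>b \<in> C\<close> by (auto simp: S_def Kset_def)
    moreover have "b \<notin> fst ` S"
      using \<delta>(2) that(2) by (auto simp: subset_iff)
    ultimately show "peval2 l b x \<le> t"
      by (metis fst_conv image_eqI nle_le)
  qed (use J(1) assms(4) in simp)
  then show ?thesis
    using \<delta>(1) by blast
qed

section \<open>The sum-of-squares programs\<close>

lemma sos_msubst:
  fixes s :: "'v::finite \<Rightarrow> 'w mpoly"
  assumes "sos p"
  shows "sos (msubst s p)"
proof -
  obtain qs where qs: "p = (\<Sum>q\<leftarrow>qs. q ^ 2)"
    using assms by (auto simp: sos_def)
  have "sos (msubst s (\<Sum>q\<leftarrow>qs. q ^ 2))"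
    by (induction qs) (simp_all add: sos_add)
  then show ?thesis
    by (simp add: qs)
qed

lemma msubst_quadratic_module:
  fixes s :: "'v::finite \<Rightarrow> 'w mpoly"
  assumes "p \<in> quadratic_module gs" and "\<And>g. g \<in> set gs \<Longrightarrow> msubst s g \<in> quadratic_module gs'"
  shows "msubst s p \<in> quadratic_module gs'"
proof -
  obtain t \<sigma> where p: "p = t + (\<Sum>j<length gs. \<sigma> j * gs ! j)" "sos t" "\<forall>j<length gs. sos (\<sigma> j)"
    using assms(1) by (auto simp: quadratic_module_def)
  have "msubst s (\<sigma> j) * msubst s (gs ! j) \<in> quadratic_module gs'" if "j < length gs" for j
    using p(3) assms(2) that by (intro quadratic_module_sos_mult[OF sos_msubst]) auto
  then have "msubst s t + (\<Sum>j<length gs. msubst s (\<sigma> j) * msubst s (gs ! j)) \<in> quadratic_module gs'"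
    using p(2) by (intro quadratic_module_add[OF sos_in_quadratic_module[OF sos_msubst]] quadratic_module_sum) auto
  then show ?thesis
    by (simp add: p(1))
qed

text \<open>The signs are flipped because the sets are described by \<le> 0 and the module by \<ge>
  0. The order of the three blocks is that of the sums in \<open>sos_representation\<close>.\<close>

definition joint_generators ::
    "'m mpoly list \<Rightarrow> 'n mpoly list \<Rightarrow> ('m + 'n) mpoly list \<Rightarrow> ('m + 'n) mpoly list" where
  "joint_generators ha hx gs = map uminus (gs @ map in_params ha @ map in_state hx)"

text \<open>Renaming variables carries the ball certificates for parameters and for states into the
  joint ring; their sum bounds the joint norm.\<close>

lemma archimedean_joint:
  fixes ha :: "'m::finite mpoly list" and hx :: "'n::finite mpoly list"
  assumes "archimedean (quadratic_module (map uminus ha))"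
    and "archimedean (quadratic_module (map uminus hx))"
  shows "archimedean (quadratic_module (joint_generators ha hx gs))"
proof -
  let ?Q = "quadratic_module (joint_generators ha hx gs)"
  obtain A where A: "0 < A" "mconst A - (\<Sum>v\<in>UNIV. mvar v ^ 2) \<in> quadratic_module (map uminus ha)"
    using assms(1) by (auto simp: archimedean_def)
  obtain B where B: "0 < B" "mconst B - (\<Sum>v\<in>UNIV. mvar v ^ 2) \<in> quadratic_module (map uminus hx)"
    using assms(2) by (auto simp: archimedean_def)
  have "msubst (\<lambda>j. mvar (Inl j)) (mconst A - (\<Sum>v\<in>UNIV. mvar v ^ 2)) \<in> ?Q"
    by (rule msubst_quadratic_module[OF A(2)])
      (auto intro!: generator_in_quadratic_module simp: joint_generators_def in_params_def)
  moreover have "msubst (\<lambda>j. mvar (Inr j)) (mconst B - (\<Sum>v\<in>UNIV. mvar v ^ 2)) \<in> ?Q"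
    by (rule msubst_quadratic_module[OF B(2)])
      (auto intro!: generator_in_quadratic_module simp: joint_generators_def in_state_def)
  ultimately have "(mconst A - (\<Sum>j\<in>UNIV. mvar (Inl j) ^ 2)) + (mconst B - (\<Sum>v\<in>UNIV. mvar (Inr v) ^ 2)) \<in> ?Q"
    using quadratic_module_add by fastforce
  moreover have "(\<Sum>w\<in>(UNIV :: ('m + 'n) set). mvar w ^ 2) =
      (\<Sum>j\<in>UNIV. mvar (Inl j) ^ 2) + (\<Sum>v\<in>UNIV. mvar (Inr v) ^ 2)"
    by (simp add: UNIV_Plus_UNIV[symmetric] sum.Plus del: UNIV_Plus_UNIV)
  ultimately have "mconst (A + B) - (\<Sum>w\<in>UNIV. mvar w ^ 2) \<in> ?Q"
    by (simp add: mconst_hom algebra_simps)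
  then show ?thesis
    using A(1) B(1) by (auto simp: archimedean_def intro!: exI[of _ "A + B"])
qed

text \<open>Putinar's theorem is applied in the joint variables, which yields one certificate for
  all parameters simultaneously instead of one for each \<open>a\<close>.\<close>

lemma in_joint_quadratic_module:
  fixes ha :: "'m::finite mpoly list" and hx :: "'n::finite mpoly list"
  assumes "archimedean (quadratic_module (map uminus ha))"
    and "archimedean (quadratic_module (map uminus hx))"
    and pos: "\<And>a x. a \<in> basic_set ha \<Longrightarrow> x \<in> Kset hx gs a \<Longrightarrow> 0 < peval2 q a x"
  shows "q \<in> quadratic_module (joint_generators ha hx gs)"
proof (rule putinar[OF archimedean_joint[OF assms(1,2)]])
  fix w assume w: "\<And>g. g \<in> set (joint_generators ha hx gs) \<Longrightarrow> 0 \<le> meval g w"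
  define a :: "real ^ 'm" where "a = (\<chi> j. w (Inl j))"
  define x :: "real ^ 'n" where "x = (\<chi> v. w (Inr v))"
  have "case_sum (($) a) (($) x) = w"
    by (auto simp: a_def x_def fun_eq_iff split: sum.split)
  then have w_eq: "meval g w = peval2 g a x" for g
    by (simp add: peval2_def)
  have neg: "meval g w \<le> 0" if "g \<in> set (gs @ map in_params ha @ map in_state hx)" for g
    using w[of "- g"] that unfolding joint_generators_def by auto
  have "peval2 g a x \<le> 0" if "g \<in> set gs" for g
    using neg[of g] that by (simp add: w_eq)
  moreover have "peval h a \<le> 0" if "h \<in> set ha" for h
    using neg[of "in_params h"] that by (simp add: w_eq)
  moreover have "peval h x \<le> 0" if "h \<in> set hx" for h
    using neg[of "in_state h"] that by (simp add: w_eq)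
  ultimately show "0 < meval q w"
    unfolding w_eq by (intro pos) (auto simp: Kset_def basic_set_def)
qed

lemma sum_nth_append:
  "(\<Sum>j<length (xs @ ys). F j ((xs @ ys) ! j)) =
    (\<Sum>j<length xs. F j (xs ! j)) + (\<Sum>j<length ys. F (length xs + j) (ys ! j))"
  for F :: "nat \<Rightarrow> 'a \<Rightarrow> 'b::comm_monoid_add"
proof (induction xs arbitrary: F)
  case (Cons x xs)
  show ?case
    using Cons[of "\<lambda>j. F (Suc j)"] by (simp add: sum.lessThan_Suc_shift add.assoc del: sum.lessThan_Suc)
qed simp

text \<open>A certificate has finitely many multipliers, so it fits every degree bound above the sum
  of their degrees.\<close>

lemma sos_representation_if_in_joint_quadratic_module:
  assumes "q \<in> quadratic_module (joint_generators ha hx gs)"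
  shows "\<exists>d0. \<forall>d\<ge>d0. sos_representation d ha hx gs q"
proof -
  let ?gs = "gs @ map in_params ha @ map in_state hx"
  let ?L = "length gs + length ha + length hx"
  obtain s \<sigma> where q: "q = s + (\<Sum>j<length ?gs. \<sigma> j * map uminus ?gs ! j)"
    and sos: "sos s" "\<forall>j<?L. sos (\<sigma> j)"
    using assms by (auto simp: quadratic_module_def joint_generators_def)
  have "(\<Sum>j<length zs. \<sigma> j * map uminus zs ! j) = - (\<Sum>j<length zs. \<sigma> j * zs ! j)" for zs
    by (simp add: sum_negf)
  then have "q = s - (\<Sum>j<length ?gs. \<sigma> j * ?gs ! j)"
    unfolding q by (simp only: add_uminus_conv_diff)
  also have "(\<Sum>j<length ?gs. \<sigma> j * ?gs ! j) = (\<Sum>r<length gs. \<sigma> r * gs ! r) +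
      ((\<Sum>r<length ha. \<sigma> (length gs + r) * in_params (ha ! r)) +
       (\<Sum>r<length hx. \<sigma> (length gs + length ha + r) * in_state (hx ! r)))"
    by (subst sum_nth_append[of "\<lambda>j g. \<sigma> j * g"], subst sum_nth_append[of "\<lambda>j g. \<sigma> (length gs + j) * g"])
      (simp add: add.assoc)
  finally have q': "q = s - (\<Sum>r<length gs. \<sigma> r * gs ! r)
      - (\<Sum>r<length ha. \<sigma> (length gs + r) * in_params (ha ! r))
      - (\<Sum>r<length hx. \<sigma> (length gs + length ha + r) * in_state (hx ! r))"
    by (simp only: diff_diff_eq add.assoc)
  define d0 where "d0 = total_deg s + (\<Sum>j<?L. total_deg (\<sigma> j))"
  have deg: "sos_deg d s" "\<And>j. j < ?L \<Longrightarrow> sos_deg d (\<sigma> j)" if "d0 \<le> d" for d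
  proof -
    show "sos_deg d s"
      using that sos by (simp add: sos_deg_def d0_def)
    show "sos_deg d (\<sigma> j)" if j: "j < ?L" for j
      using \<open>d0 \<le> d\<close> sos j member_le_sum[of j "{..<?L}" "\<lambda>j. total_deg (\<sigma> j)"]
      by (simp add: sos_deg_def d0_def)
  qed
  have "sos_representation d ha hx gs q" if "d0 \<le> d" for d
    unfolding sos_representation_def
    using deg[OF that] q'
    by (intro exI[of _ s] exI[of _ \<sigma>] exI[of _ "\<lambda>r. \<sigma> (length gs + r)"]
        exI[of _ "\<lambda>r. \<sigma> (length gs + length ha + r)"]) auto
  then show ?thesis
    by blast
qed

section \<open>Addition and soundness of degree-bounded certificates, and the objective as a mean
  value\<close>

lemma total_deg_le_iff: "total_deg p \<le> n \<longleftrightarrow> (\<forall>\<alpha>\<in>Poly_Mapping.keys p. monom_deg \<alpha> \<le> n)"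
  by (simp add: total_deg_def)

lemma total_deg_add_le: "total_deg p \<le> n \<Longrightarrow> total_deg q \<le> n \<Longrightarrow> total_deg (p + q) \<le> n"
  unfolding total_deg_le_iff using Poly_Mapping.keys_add[of p q] by blast

lemma sos_deg_add: "sos_deg d p \<Longrightarrow> sos_deg d q \<Longrightarrow> sos_deg d (p + q)"
  by (simp add: sos_deg_def sos_add total_deg_add_le)

lemma sos_representation_add:
  assumes "sos_representation d ha hx gs p" "sos_representation d ha hx gs q"
  shows "sos_representation d ha hx gs (p + q)"
proof -
  obtain s sK sa sx where p: "p = s - (\<Sum>r<length gs. sK r * gs ! r)
      - (\<Sum>r<length ha. sa r * in_params (ha ! r)) - (\<Sum>r<length hx. sx r * in_state (hx ! r))"
    "sos_deg d s" "\<forall>r<length gs. sos_deg d (sK r)" "\<forall>r<length ha. sos_deg d (sa r)" "\<forall>r<length hx. sos_deg d (sx r)"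
    using assms(1) unfolding sos_representation_def by (elim exE conjE) (rule that)
  obtain s' sK' sa' sx' where q: "q = s' - (\<Sum>r<length gs. sK' r * gs ! r)
      - (\<Sum>r<length ha. sa' r * in_params (ha ! r)) - (\<Sum>r<length hx. sx' r * in_state (hx ! r))"
    "sos_deg d s'" "\<forall>r<length gs. sos_deg d (sK' r)" "\<forall>r<length ha. sos_deg d (sa' r)" "\<forall>r<length hx. sos_deg d (sx' r)"
    using assms(2) unfolding sos_representation_def by (elim exE conjE) (rule that)
  show ?thesis
    unfolding sos_representation_def
  proof (intro exI conjI allI impI)
    show "p + q = (s + s')
      - (\<Sum>r<length gs. (sK r + sK' r) * gs ! r)
      - (\<Sum>r<length ha. (sa r + sa' r) * in_params (ha ! r))
      - (\<Sum>r<length hx. (sx r + sx' r) * in_state (hx ! r))"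
      unfolding p(1) q(1)
      by (simp add: distrib_right sum.distrib)
  qed (use p q in \<open>auto intro!: sos_deg_add\<close>)
qed

lemma sos_representation_nonneg:
  fixes ha :: "'m::finite mpoly list" and hx :: "'n::finite mpoly list"
  assumes "sos_representation d ha hx gs q" "a \<in> basic_set ha" "x \<in> Kset hx gs a"
  shows "0 \<le> peval2 q a x"
proof -
  let ?w = "case_sum (($) a) (($) x)"
  obtain s sK sa sx where q: "q = s - (\<Sum>r<length gs. sK r * gs ! r)
      - (\<Sum>r<length ha. sa r * in_params (ha ! r)) - (\<Sum>r<length hx. sx r * in_state (hx ! r))"
    "sos_deg d s" "\<forall>r<length gs. sos_deg d (sK r)" "\<forall>r<length ha. sos_deg d (sa r)" "\<forall>r<length hx. sos_deg d (sx r)"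
    using assms(1) unfolding sos_representation_def by (elim exE conjE) (rule that)
  have eq: "meval r ?w = peval2 r a x" for r
    by (simp add: peval2_def)
  have "(\<Sum>r<length gs. meval (sK r) ?w * peval2 (gs ! r) a x) \<le> 0"
    using q assms by (intro sum_nonpos mult_nonneg_nonpos sos_nonneg) (auto simp: sos_deg_def Kset_def)
  moreover have "(\<Sum>r<length ha. meval (sa r) ?w * peval (ha ! r) a) \<le> 0"
    using q assms by (intro sum_nonpos mult_nonneg_nonpos sos_nonneg) (auto simp: sos_deg_def basic_set_def)
  moreover have "(\<Sum>r<length hx. meval (sx r) ?w * peval (hx ! r) x) \<le> 0"
    using q assms by (intro sum_nonpos mult_nonneg_nonpos sos_nonneg) (auto simp: sos_deg_def Kset_def basic_set_def)
  moreover have "0 \<le> meval s ?w"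
    using q by (intro sos_nonneg) (auto simp: sos_deg_def)
  moreover have "peval2 q a x = meval s ?w - (\<Sum>r<length gs. meval (sK r) ?w * peval2 (gs ! r) a x)
      - (\<Sum>r<length ha. meval (sa r) ?w * peval (ha ! r) a) - (\<Sum>r<length hx. meval (sx r) ?w * peval (hx ! r) x)"
    unfolding q(1) peval2_in_params[symmetric, of _ a x] peval2_in_state[symmetric, of _ x a]
    by (simp add: peval2_def)
  ultimately show ?thesis
    by linarith
qed

text \<open>The objective sums over this set; over an infinite index set the sum would be 0 by
  convention.\<close>

lemma finite_monom_deg_le: "finite {\<alpha> :: 'v::finite \<Rightarrow>\<^sub>0 nat. monom_deg \<alpha> \<le> n}"
proof (rule finite_imageD[where f = Poly_Mapping.lookup])
  have le: "Poly_Mapping.lookup \<alpha> v \<le> monom_deg \<alpha>" for \<alpha> :: "'v \<Rightarrow>\<^sub>0 nat" and v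
  proof (cases "v \<in> Poly_Mapping.keys \<alpha>")
    case True
    then show ?thesis
      unfolding monom_deg_def by (intro member_le_sum) auto
  qed (simp add: in_keys_iff)
  have "Poly_Mapping.lookup ` {\<alpha> :: 'v \<Rightarrow>\<^sub>0 nat. monom_deg \<alpha> \<le> n} \<subseteq> PiE UNIV (\<lambda>_. {..n})"
    using order.trans[OF le] by (auto simp: PiE_def)
  then show "finite (Poly_Mapping.lookup ` {\<alpha> :: 'v \<Rightarrow>\<^sub>0 nat. monom_deg \<alpha> \<le> n})"
    by (rule finite_subset) (intro finite_PiE finite finite_atMost)
  show "inj_on Poly_Mapping.lookup {\<alpha> :: 'v \<Rightarrow>\<^sub>0 nat. monom_deg \<alpha> \<le> n}"
    by (rule inj_onI) (simp only: poly_mapping_eq_iff)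
qed

lemma sos_objective_eq_integral:
  fixes ha :: "'m::finite mpoly list"
  assumes C: "compact (basic_set ha)" and "total_deg p \<le> 2 * d"
  shows "sos_objective d ha p = (LINT a:basic_set ha|lebesgue. peval p a) / measure lebesgue (basic_set ha)"
proof -
  let ?C = "basic_set ha" and ?K = "Poly_Mapping.keys p"
  have int: "set_integrable lebesgue ?C (\<lambda>a. Poly_Mapping.lookup p \<alpha> * monom_eval \<alpha> (($) a))" for \<alpha>
    unfolding monom_eval_def by (intro set_integrable_lebesgue_compact[OF C] continuous_intros)
  have "sos_objective d ha p = (\<Sum>\<alpha>\<in>?K. moment ha \<alpha> * Poly_Mapping.lookup p \<alpha>)"
    unfolding sos_objective_def using assms(2)
    by (intro sum.mono_neutral_right finite_monom_deg_le) (auto simp: total_deg_le_iff in_keys_iff)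
  also have "\<dots> = (\<Sum>\<alpha>\<in>?K. LINT a:?C|lebesgue. Poly_Mapping.lookup p \<alpha> * monom_eval \<alpha> (($) a)) / measure lebesgue ?C"
    by (simp add: moment_def sum_divide_distrib mult.commute)
  also have "(\<Sum>\<alpha>\<in>?K. LINT a:?C|lebesgue. Poly_Mapping.lookup p \<alpha> * monom_eval \<alpha> (($) a)) =
      (LINT a:?C|lebesgue. peval p a)"
    unfolding peval_def meval_def set_lebesgue_integral_def scaleR_sum_right
    using int by (intro Bochner_Integration.integral_sum[symmetric]) (simp add: set_integrable_def)
  finally show ?thesis .
qed

text \<open>Both certificates contain multipliers of the premises, so even the bound by
  \<open>- M\<close> needs a witness \<open>x\<close> in K(a).\<close>

lemma sos_feasible_bounds:
  fixes ha :: "'m::finite mpoly list" and hx :: "'n::finite mpoly list"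
  assumes "sos_feasible d M ha hx gs l q" "a \<in> basic_set ha" "x \<in> Kset hx gs a"
  shows "peval2 l a x \<le> peval q a" "- M \<le> peval q a"
proof -
  have "0 \<le> peval2 (in_params q - l) a x" "0 \<le> peval2 (in_params q + mconst M) a x"
    using assms sos_representation_nonneg unfolding sos_feasible_def by blast+
  then show "peval2 l a x \<le> peval q a" "- M \<le> peval q a"
    using peval2_in_params[of q a x] by (simp_all add: peval2_def)
qed

lemma in_params_add: "in_params (p + q) = in_params p + in_params q"
  by (simp add: in_params_def)

text \<open>Provides the competitor in the perturbation of an optimal solution: the constraints are
  affine in \<open>p\<close>, and certificates within a degree bound can be added.\<close>

lemma sos_feasible_add:
  assumes "sos_feasible d M ha hx gs l p"
    and "sos_representation d ha hx gs (in_params q)" "total_deg q \<le> 2 * d"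
  shows "sos_feasible d M ha hx gs l (p + q)"
proof -
  have "sos_representation d ha hx gs ((in_params p - l) + in_params q)"
    "sos_representation d ha hx gs ((in_params p + mconst M) + in_params q)"
    using assms by (auto simp: sos_feasible_def intro!: sos_representation_add)
  then show ?thesis
    using assms by (simp add: sos_feasible_def total_deg_add_le in_params_add algebra_simps)
qed

text \<open>The target \<open>l\<close> and the cutoff \<open>M\<close> stay free, because the
  results are also applied to the auxiliary target 0 with cutoff 1.\<close>

locale verification_condition =
  fixes hx :: "'n::finite mpoly list" and ha :: "'m::finite mpoly list"
    and gs :: "('m + 'n) mpoly list"
  assumes compact_x: "compact (basic_set hx)"
    and compact_a: "compact (basic_set ha)"
    and arch_x: "archimedean (quadratic_module (map uminus hx))"
    and arch_a: "archimedean (quadratic_module (map uminus ha))"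
begin

lemma Jreal_integrable: "set_integrable lebesgue (basic_set ha) (Jreal M hx gs l)"
  and Jreal_polynomial_upper_approximation: "0 < \<epsilon> \<Longrightarrow> \<exists>q. (\<forall>a\<in>basic_set ha. Jreal M hx gs l a < peval q a) \<and>
    (LINT a:basic_set ha|lebesgue. peval q a) \<le> (LINT a:basic_set ha|lebesgue. Jreal M hx gs l a) + \<epsilon>"
proof -
  obtain B where "\<And>a. a \<in> basic_set ha \<Longrightarrow> Jfun M hx gs l a \<le> ereal B"
    using Jfun_bounded[OF compact_x compact_a] by blast
  then have bounds: "- M \<le> Jreal M hx gs l a \<and> Jreal M hx gs l a \<le> B" if "a \<in> basic_set ha" for a
    using that Jreal_le_iff[OF compact_x, of M gs l a "Jreal M hx gs l a"]
    by (simp flip: ereal_Jreal[OF compact_x])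
  show "set_integrable lebesgue (basic_set ha) (Jreal M hx gs l)"
    using usc_upper_approximation(1)[OF compact_a bounds Jreal_usc[OF compact_x compact_a]] .
  show "\<exists>q. (\<forall>a\<in>basic_set ha. Jreal M hx gs l a < peval q a) \<and>
    (LINT a:basic_set ha|lebesgue. peval q a) \<le> (LINT a:basic_set ha|lebesgue. Jreal M hx gs l a) + \<epsilon>"
    if "0 < \<epsilon>"
    using usc_polynomial_upper_approximation[OF compact_a bounds Jreal_usc[OF compact_x compact_a] that] .
qed

lemma feasible_approximation:
  assumes "0 < \<epsilon>"
  shows "\<exists>q d0. (\<forall>d\<ge>d0. sos_feasible d M ha hx gs l q) \<and>
    (LINT a:basic_set ha|lebesgue. peval q a) \<le> (LINT a:basic_set ha|lebesgue. Jreal M hx gs l a) + \<epsilon>"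
proof -
  obtain q where q: "\<And>a. a \<in> basic_set ha \<Longrightarrow> Jreal M hx gs l a < peval q a"
    and int: "(LINT a:basic_set ha|lebesgue. peval q a) \<le> (LINT a:basic_set ha|lebesgue. Jreal M hx gs l a) + \<epsilon>"
    using Jreal_polynomial_upper_approximation[OF assms] by blast
  have J: "- M < peval q a" "\<And>x. x \<in> Kset hx gs a \<Longrightarrow> peval2 l a x < peval q a" if "a \<in> basic_set ha" for a
    using q[OF that] Jreal_le_iff[OF compact_x, of M gs l a "Jreal M hx gs l a"] by auto
  have eval: "peval2 (in_params q - l) a x = peval q a - peval2 l a x"
      "peval2 (in_params q + mconst M) a x = peval q a + M" for a x
    using peval2_in_params[of q a x] by (simp_all add: peval2_def)
  have "in_params q - l \<in> quadratic_module (joint_generators ha hx gs)"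
    "in_params q + mconst M \<in> quadratic_module (joint_generators ha hx gs)"
    using J by (auto intro!: in_joint_quadratic_module[OF arch_a arch_x] simp: eval add.commute less_diff_eq minus_less_iff)
      (smt (verit))
  then obtain d1 d2 where "\<forall>d\<ge>d1. sos_representation d ha hx gs (in_params q - l)"
    "\<forall>d\<ge>d2. sos_representation d ha hx gs (in_params q + mconst M)"
    using sos_representation_if_in_joint_quadratic_module by metis
  then have "\<forall>d\<ge>max (total_deg q) (max d1 d2). sos_feasible d M ha hx gs l q"
    by (auto simp: sos_feasible_def)
  then show ?thesis
    using int by blast
qed

text \<open>
  The constraints say nothing about \<open>p\<close> where \<open>K(a)\<close> is empty. If that happened on a set of
  positive measure, there would be a polynomial \<open>q\<close> with negative integral which is positive
  where \<open>K(a)\<close> is nonempty, and adding \<open>q\<close> to an optimal solution would improve it.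
\<close>

lemma AE_Kset_nonempty:
  assumes pos: "0 < measure lebesgue (basic_set ha)"
    and optimal: "\<And>d. \<exists>p. sos_optimal d M ha hx gs l p"
  shows "AE a in lebesgue. a \<in> basic_set ha \<longrightarrow> Kset hx gs a \<noteq> {}"
proof -
  \<comment> \<open>This value function is minus the indicator of the parameters with empty K(a):
    the target 0 gives 0 where K(a) has a point, and the cutoff gives -1 elsewhere. Its integral is
    therefore negative unless such parameters form a null set.\<close>
  let ?C = "basic_set ha" and ?J = "Jreal 1 hx gs 0"
  have J: "?J a \<le> 0" "Kset hx gs a = {} \<Longrightarrow> ?J a \<le> - 1" for a
    by (simp_all add: Jreal_le_iff[OF compact_x] peval2_def)
  have "0 \<le> (LINT a:?C|lebesgue. ?J a)"
  proof (rule ccontr)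
    assume neg: "\<not> 0 \<le> (LINT a:?C|lebesgue. ?J a)"
    then obtain q d where q: "sos_feasible d 1 ha hx gs 0 q" and
      "(LINT a:?C|lebesgue. peval q a) \<le> (LINT a:?C|lebesgue. ?J a) + (- (LINT a:?C|lebesgue. ?J a) / 2)"
      using feasible_approximation[of "- (LINT a:?C|lebesgue. ?J a) / 2" 1 0] by force
    with neg have int_q: "(LINT a:?C|lebesgue. peval q a) < 0"
      by linarith
    \<comment> \<open>Solvability is invoked at the degree where \<open>q\<close> is certified.
      Since the target of \<open>q\<close> is 0, its first constraint is exactly the certificate
      required to add it to \<open>p\<close>.\<close>
    obtain p where p: "sos_optimal d M ha hx gs l p"
      using optimal by blast
    then have p_feasible: "sos_feasible d M ha hx gs l p"
      by (simp add: sos_optimal_def)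
    have "sos_feasible d M ha hx gs l (p + q)"
      using q by (intro sos_feasible_add p_feasible) (simp_all add: sos_feasible_def)
    then have "sos_objective d ha p \<le> sos_objective d ha (p + q)"
      using p by (simp add: sos_optimal_def)
    moreover have "sos_objective d ha (p + q) = sos_objective d ha p + sos_objective d ha q"
      by (simp add: sos_objective_def lookup_add distrib_left sum.distrib)
    moreover have "sos_objective d ha q < 0"
      using int_q pos q sos_objective_eq_integral[OF compact_a, of q d]
      by (simp add: sos_feasible_def divide_neg_pos)
    ultimately show False
      by linarith
  qed
  then have le: "(LINT a|lebesgue. indicator ?C a *\<^sub>R (- ?J a)) \<le> 0"
    by (simp add: set_lebesgue_integral_def)
  have int: "integrable lebesgue (\<lambda>a. indicator ?C a *\<^sub>R (- ?J a))"
    using Jreal_integrable[of 1 0] by (simp add: set_integrable_def)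
  have nonneg: "0 \<le> indicator ?C a *\<^sub>R (- ?J a)" for a
    using J(1)[of a] by (simp add: indicator_def)
  have "(LINT a|lebesgue. indicator ?C a *\<^sub>R (- ?J a)) = 0"
    using le nonneg by (intro antisym integral_nonneg_AE) auto
  then have "AE a in lebesgue. indicator ?C a *\<^sub>R (- ?J a) = 0"
    using integral_nonneg_eq_0_iff_AE[OF int] nonneg by simp
  then show ?thesis
    by eventually_elim (use J(2) in \<open>force simp: indicator_def split: if_splits\<close>)
qed

text \<open>An optimal solution is no worse than a fixed feasible \<open>q\<close>. This is the
  upper half of convergence; the lower half comes from \<open>p\<close> dominating the value
  function almost everywhere.\<close>

lemma optimal_integral_converges:
  assumes "0 < measure lebesgue (basic_set ha)" "0 < \<epsilon>"
  shows "\<exists>d0. \<forall>d\<ge>d0. \<forall>p. sos_optimal d M ha hx gs l p \<longrightarrow>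
    (LINT a:basic_set ha|lebesgue. peval p a) \<le> (LINT a:basic_set ha|lebesgue. Jreal M hx gs l a) + \<epsilon>"
proof -
  obtain q d0 where q: "\<And>d. d0 \<le> d \<Longrightarrow> sos_feasible d M ha hx gs l q" and
    int: "(LINT a:basic_set ha|lebesgue. peval q a) \<le> (LINT a:basic_set ha|lebesgue. Jreal M hx gs l a) + \<epsilon>"
    using feasible_approximation[OF assms(2)] by blast
  have "(LINT a:basic_set ha|lebesgue. peval p a) \<le> (LINT a:basic_set ha|lebesgue. peval q a)"
    if "d0 \<le> d" "sos_optimal d M ha hx gs l p" for d p
  proof -
    have "sos_objective d ha p \<le> sos_objective d ha q"
      using that q by (simp add: sos_optimal_def)
    moreover have "total_deg p \<le> 2 * d" "total_deg q \<le> 2 * d"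
      using that q by (auto simp: sos_optimal_def sos_feasible_def)
    ultimately show ?thesis
      using assms(1) by (simp add: sos_objective_eq_integral[OF compact_a] divide_le_cancel)
  qed
  then show ?thesis
    using int by (meson order.trans)
qed

end

text \<open>Points of \<open>U\<close> with \<open>p > 0\<close> are of two kinds. Either
  \<open>J\<close> is close to 0, which happens on a set of small measure by continuity from above,
  or \<open>p - J\<close> exceeds a fixed \<delta>, which Markov's inequality makes rare. The first
  set does not depend on \<open>p\<close>, so \<epsilon> can be chosen before
  \<open>p\<close>.\<close>

lemma measure_positive_set_of_upper_approximation:
  fixes J :: "'a::euclidean_space \<Rightarrow> real"
  assumes J: "set_integrable lebesgue C J" and C: "C \<in> lmeasurable" and U: "U \<subseteq> C" "U \<in> sets lebesgue"
    and neg: "AE a in lebesgue. a \<in> U \<longrightarrow> J a < 0" and "0 < \<eta>"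
  shows "\<exists>\<epsilon>>0. \<forall>p. set_integrable lebesgue C p \<longrightarrow> (AE a in lebesgue. a \<in> C \<longrightarrow> J a \<le> p a) \<longrightarrow>
    (LINT a:C|lebesgue. p a) \<le> (LINT a:C|lebesgue. J a) + \<epsilon> \<longrightarrow> measure lebesgue {a \<in> U. 0 < p a} < \<eta>"
proof -
  define A where "A n = {a \<in> U. - 1 / Suc n \<le> J a}" for n
  \<comment> \<open>Integrability on \<open>C\<close> gives measurability only of the extension by
    0, which agrees with \<open>f\<close> on \<open>U\<close>.\<close>
  have meas: "{a \<in> U. P (f a)} \<in> sets lebesgue"
    if "set_integrable lebesgue C f" "Measurable.pred borel P" for f :: "'a \<Rightarrow> real" and P
  proof -
    have [measurable]: "(\<lambda>a. indicator C a *\<^sub>R f a) \<in> borel_measurable lebesgue"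
      using that(1) by (simp add: set_integrable_def borel_measurable_integrable)
    have "{a \<in> space lebesgue. P (indicator C a *\<^sub>R f a)} \<in> sets lebesgue"
      using that(2) by measurable
    moreover have "{a \<in> U. P (f a)} = U \<inter> {a \<in> space lebesgue. P (indicator C a *\<^sub>R f a)}"
      using U(1) by auto
    ultimately show ?thesis
      using U(2) by (simp add: sets.Int)
  qed
  have lmeas: "X \<in> lmeasurable" if "X \<subseteq> C" "X \<in> sets lebesgue" for X
    using fmeasurableI2[OF C that] .
  have A: "A n \<in> lmeasurable" for n
    using meas[OF J, of "\<lambda>t. - 1 / Suc n \<le> t"] U
    by (intro lmeas) (auto simp: A_def)
  have "(\<lambda>n. measure lebesgue (A n)) \<longlonglongrightarrow> measure lebesgue (\<Inter>n. A n)"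
  proof (rule Lim_measure_decseq)
    show "decseq A"
      by (auto simp: decseq_def A_def frac_le elim!: order.trans[rotated])
  qed (use A fmeasurableD2[OF A] in auto)
  moreover have "measure lebesgue (\<Inter>n. A n) = 0"
  proof -
    have "AE a in lebesgue. a \<notin> (\<Inter>n. A n)"
      using neg
    proof eventually_elim
      case (elim a)
      show ?case
      proof
        assume a: "a \<in> (\<Inter>n. A n)"
        then have "0 < - J a"
          using elim by (auto simp: A_def)
        then obtain n where "inverse (real (Suc n)) < - J a"
          using reals_Archimedean by blast
        moreover have "- 1 / Suc n \<le> J a"
          using a by (auto simp: A_def)
        ultimately show False
          by (simp add: inverse_eq_divide)
      qed
    qed
    moreover have "(\<Inter>n. A n) \<in> sets lebesgue"
      using A by (intro sets.countable_INT) auto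
    ultimately show ?thesis
      using AE_iff_null_sets measure_eq_0_null_sets by blast
  qed
  ultimately have "\<forall>\<^sub>F n in sequentially. measure lebesgue (A n) < \<eta> / 2"
    using \<open>0 < \<eta>\<close> by (intro order_tendstoD) auto
  then obtain n where n: "measure lebesgue (A n) < \<eta> / 2"
    by (meson eventually_happens sequentially_bot)
  define \<delta> :: real where "\<delta> = 1 / Suc n"
  have "0 < \<delta>"
    by (simp add: \<delta>_def)
  show ?thesis
  \<comment> \<open>Markov's inequality at level \<delta> turns this integral excess into measure at
    most \<eta> / 2; the set \<open>A n\<close> takes the other half.\<close>
  proof (intro exI[of _ "\<delta> * \<eta> / 2"] conjI allI impI)
    show "0 < \<delta> * \<eta> / 2"
      using \<open>0 < \<delta>\<close> \<open>0 < \<eta>\<close> by simp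
    fix p assume p: "set_integrable lebesgue C p" "AE a in lebesgue. a \<in> C \<longrightarrow> J a \<le> p a"
      "(LINT a:C|lebesgue. p a) \<le> (LINT a:C|lebesgue. J a) + \<delta> * \<eta> / 2"
    let ?u = "\<lambda>a. indicator C a *\<^sub>R (p a - J a)" and ?P = "{a \<in> U. 0 < p a}"
    let ?B = "{a \<in> space lebesgue. \<delta> \<le> ?u a}"
    have int: "integrable lebesgue ?u"
      using set_integral_diff(1)[OF p(1) J] by (simp add: set_integrable_def)
    have nonneg: "AE a in lebesgue. 0 \<le> ?u a"
      using p(2) by eventually_elim (simp add: indicator_def)
    have "measure lebesgue ?B \<le> (LINT a|lebesgue. ?u a) / \<delta>"
      by (rule integral_Markov_inequality_measure[OF int, of "{}"]) (use nonneg \<open>0 < \<delta>\<close> in auto)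
    also have "(LINT a|lebesgue. ?u a) \<le> \<delta> * \<eta> / 2"
      using p(3) set_integral_diff(2)[OF p(1) J] by (simp add: set_lebesgue_integral_def)
    finally have B: "measure lebesgue ?B \<le> \<eta> / 2"
      using \<open>0 < \<delta>\<close> by (simp add: divide_right_mono)
    have P: "?P \<in> lmeasurable"
      using meas[OF p(1), of "\<lambda>t. 0 < t"] U by (intro lmeas) auto
    have "?B \<subseteq> C"
      using \<open>0 < \<delta>\<close> by (auto simp: indicator_def split: if_splits)
    moreover have "?B \<in> sets lebesgue"
      using borel_measurable_integrable[OF int] by measurable
    ultimately have B_meas: "?B \<in> lmeasurable"
      by (rule lmeas)
    have "measure lebesgue ?P \<le> measure lebesgue (A n \<union> ?B)"
      using P A B_meas U(1)
      by (intro measure_mono_fmeasurable fmeasurable.Un fmeasurableD)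
        (auto simp: A_def \<delta>_def not_le)
    also have "\<dots> \<le> measure lebesgue (A n) + measure lebesgue ?B"
      using A B_meas by (intro measure_Un_le) auto
    finally show "measure lebesgue ?P < \<eta>"
      using n B by linarith
  qed
qed

context verification_condition
begin

lemma measure_optimal_positive_set:
  assumes pos: "0 < measure lebesgue (basic_set ha)"
    and solvable: "\<And>d. \<exists>p. sos_optimal d M ha hx gs l p"
    and U: "U \<subseteq> basic_set ha" "U \<in> sets lebesgue"
    and neg: "AE a in lebesgue. a \<in> U \<longrightarrow> Jreal M hx gs l a < 0" and "0 < \<eta>"
  shows "\<exists>d0. \<forall>d\<ge>d0. \<forall>p. sos_optimal d M ha hx gs l p \<longrightarrow> measure lebesgue {a \<in> U. 0 < peval p a} < \<eta>"
proof -
  let ?C = "basic_set ha" and ?J = "Jreal M hx gs l"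
  have C: "?C \<in> lmeasurable"
    using compact_a by (rule lmeasurable_compact)
  obtain \<epsilon> where "0 < \<epsilon>" and \<epsilon>: "\<And>p. set_integrable lebesgue ?C p \<Longrightarrow>
    (AE a in lebesgue. a \<in> ?C \<longrightarrow> ?J a \<le> p a) \<Longrightarrow>
    (LINT a:?C|lebesgue. p a) \<le> (LINT a:?C|lebesgue. ?J a) + \<epsilon> \<Longrightarrow> measure lebesgue {a \<in> U. 0 < p a} < \<eta>"
    using measure_positive_set_of_upper_approximation[OF Jreal_integrable C U neg \<open>0 < \<eta>\<close>] by blast
  obtain d0 where d0: "\<And>d p. d0 \<le> d \<Longrightarrow> sos_optimal d M ha hx gs l p \<Longrightarrow>
    (LINT a:?C|lebesgue. peval p a) \<le> (LINT a:?C|lebesgue. ?J a) + \<epsilon>"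
    using optimal_integral_converges[OF pos \<open>0 < \<epsilon>\<close>] by blast
  have "measure lebesgue {a \<in> U. 0 < peval p a} < \<eta>"
    if "d0 \<le> d" "sos_optimal d M ha hx gs l p" for d p
  proof (rule \<epsilon>)
    have feasible: "sos_feasible d M ha hx gs l p"
      using that by (simp add: sos_optimal_def)
    show "AE a in lebesgue. a \<in> ?C \<longrightarrow> ?J a \<le> peval p a"
      using AE_Kset_nonempty[OF pos solvable]
    proof eventually_elim
      case (elim a)
      show ?case
        using elim sos_feasible_bounds[OF feasible] by (auto simp: Jreal_le_iff[OF compact_x])
    qed
    show "set_integrable lebesgue ?C (peval p)"
      by (intro set_integrable_lebesgue_compact compact_a continuous_on_peval)
  qed (rule d0[OF that])
  then show ?thesis
    by blast
qed

end

section \<open>Invariants as k + 2 verification conditions, and the choice of a common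
  degree\<close>

lemma peval2_target_step:
  fixes f :: "nat \<Rightarrow> 'n::finite \<Rightarrow> 'n mpoly" and T :: "('m::finite + 'n) mpoly"
  assumes "i \<in> {1..k}"
  shows "peval2 (target k Post f T i) a x = peval2 T a (\<chi> v. peval (f i v) x)"
proof -
  let ?w = "case_sum (($) a) (($) x)"
  have "(\<lambda>w. meval (case_sum (\<lambda>j. mvar (Inl j)) (\<lambda>v. in_state (f i v)) w) ?w) =
      case_sum (($) a) (\<lambda>v. peval (f i v) x)"
    using peval2_in_state[of _ a x] by (auto simp: fun_eq_iff peval2_def split: sum.split)
  then show ?thesis
    using assms by (simp add: target_def peval2_def)
qed

lemma invariant_iff:
  fixes f :: "nat \<Rightarrow> 'n::finite \<Rightarrow> 'n mpoly" and T :: "('m::finite + 'n) mpoly"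
  shows "invariant k Pre Post c f (basic_set hx) (candidate T a) \<longleftrightarrow>
    (\<forall>i\<le>k + 1. \<forall>x\<in>Kset hx (premise k Pre c T i) a. peval2 (target k Post f T i) a x \<le> 0)"
    (is "?inv \<longleftrightarrow> (\<forall>i\<le>k + 1. ?P i)")
proof -
  have neg: "peval2 (- q) a x = - peval2 q a x" for q x
    by (simp add: peval2_def)
  have K0: "x \<in> Kset hx (premise k Pre c T 0) a \<longleftrightarrow> x \<in> basic_set hx \<and> peval Pre x \<le> 0" for x
    by (simp add: Kset_def premise_def)
  have Ki: "x \<in> Kset hx (premise k Pre c T i) a \<longleftrightarrow>
      x \<in> basic_set hx \<and> (\<forall>q\<in>set (c i). peval q x \<le> 0) \<and> x \<in> candidate T a" if "i \<in> {1..k}" for x i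
    using that by (auto simp: Kset_def premise_def candidate_def)
  have Kk: "x \<in> Kset hx (premise k Pre c T (k + 1)) a \<longleftrightarrow>
      x \<in> basic_set hx \<and> (\<forall>i\<in>{1..k}. \<forall>q\<in>set (c i). peval q x \<ge> 0) \<and> x \<in> candidate T a" for x
    by (auto simp: Kset_def premise_def candidate_def neg atLeastLessThanSuc_atLeastAtMost
        simp del: upt_Suc)
  have target: "peval2 (target k Post f T 0) a x = peval2 T a x"
    "peval2 (target k Post f T (k + 1)) a x = peval Post x" for x
    by (simp_all add: target_def)
  have "{..k + 1} = insert 0 (insert (k + 1) {1..k})"
    by auto
  then have "(\<forall>i\<le>k + 1. ?P i) \<longleftrightarrow> ?P 0 \<and> ?P (k + 1) \<and> (\<forall>i\<in>{1..k}. ?P i)"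
    by (metis (no_types, lifting) atMost_iff insert_iff)
  moreover have "(\<forall>i\<in>{1..k}. ?P i) \<longleftrightarrow> (\<forall>i\<in>{1..k}. \<forall>x\<in>basic_set hx.
      (\<forall>q\<in>set (c i). peval q x \<le> 0) \<and> x \<in> candidate T a \<longrightarrow> (\<chi> v. peval (f i v) x) \<in> candidate T a)"
    by (rule ball_cong[OF refl]) (auto simp: Ki peval2_target_step candidate_def)
  moreover have "?P 0 \<longleftrightarrow> (\<forall>x\<in>basic_set hx. peval Pre x \<le> 0 \<longrightarrow> x \<in> candidate T a)"
    by (auto simp: K0 target candidate_def)
  moreover have "?P (k + 1) \<longleftrightarrow> (\<forall>x\<in>basic_set hx.
      (\<forall>i\<in>{1..k}. \<forall>q\<in>set (c i). peval q x \<ge> 0) \<and> x \<in> candidate T a \<longrightarrow> peval Post x \<le> 0)"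
    unfolding Ball_def Kk target by blast
  ultimately show ?thesis
    unfolding invariant_def by blast
qed

theorem theorem4:
  fixes k :: nat
    and Pre Post :: "'n::finite mpoly"
    and c :: "nat \<Rightarrow> 'n mpoly list"
    and f :: "nat \<Rightarrow> 'n \<Rightarrow> 'n mpoly"
    and hx :: "'n mpoly list"
    and ha :: "'m::finite mpoly list"
    and T :: "('m + 'n) mpoly"
    and M :: real
    and p :: "nat \<Rightarrow> nat \<Rightarrow> 'm mpoly"
  assumes guards_disjoint: "\<And>i j x. i \<in> {1..k} \<Longrightarrow> j \<in> {1..k} \<Longrightarrow> i \<noteq> j \<Longrightarrow>
      \<not> ((\<forall>q\<in>set (c i). peval q x \<le> 0) \<and> (\<forall>q\<in>set (c j). peval q x \<le> 0))"
    and compact_x: "compact (basic_set hx)"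
    and compact_a: "compact (basic_set ha)"
    and pos_measure: "measure lebesgue (basic_set ha) > 0"
    and M_pos: "M > 0"
    and arch_x: "archimedean (quadratic_module (map uminus hx))"
    and arch_a: "archimedean (quadratic_module (map uminus ha))"
    and arch_K: "\<And>i a. i \<le> k + 1 \<Longrightarrow> a \<in> basic_set ha \<Longrightarrow>
      archimedean (quadratic_module (map uminus (map (at_params a) (premise k Pre c T i) @ hx)))"
    and null_boundary: "\<And>i. i \<le> k + 1 \<Longrightarrow>
      {a \<in> basic_set ha. Jfun M hx (premise k Pre c T i) (target k Post f T i) a = 0}
        \<in> null_sets lebesgue"
    and interior_point: "interior (valid_set k Pre Post c f hx ha T) \<noteq> {}"
    and solvable: "\<And>d i. i \<le> k + 1 \<Longrightarrow>
      \<exists>q. sos_optimal d M ha hx (premise k Pre c T i) (target k Post f T i) q"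
    and optimal: "\<And>d i. i \<le> k + 1 \<Longrightarrow>
      sos_optimal d M ha hx (premise k Pre c T i) (target k Post f T i) (p d i)"
  shows "\<exists>d. approx_param_set k ha (p d) \<noteq> {} \<and>
      approx_param_set k ha (p d) \<subseteq> valid_set k Pre Post c f hx ha T \<and>
      (\<forall>a0\<in>approx_param_set k ha (p d).
        invariant k Pre Post c f (basic_set hx) (candidate T a0))"
proof -
  let ?C = "basic_set ha" and ?V = "valid_set k Pre Post c f hx ha T"
  let ?gs = "premise k Pre c T" and ?l = "target k Post f T"
  let ?U = "interior ?V"
  interpret verification_condition hx ha "?gs i" for i
    by unfold_locales (fact compact_x compact_a arch_x arch_a)+
  have U: "?U \<subseteq> ?C" "?U \<in> sets lebesgue"
    using interior_subset[of ?V] by (auto simp: valid_set_def)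
  \<comment> \<open>\<open>measure\<close> takes the value 0 on sets of infinite measure, so
    finiteness is secured before positivity is claimed.\<close>
  have "?U \<in> lmeasurable"
    using fmeasurableI2[OF lmeasurable_compact[OF compact_a] U] .
  then have mU: "0 < measure lebesgue ?U"
    using open_not_negligible[OF open_interior interior_point] negligible_iff_measure0
    by (metis measure_nonneg order_le_less)
  \<comment> \<open>Validity bounds the target by 0 on K_i(a), and \<open>M > 0\<close> does the
    same for the cutoff, so the value is at most 0; equality occurs only on the null
    boundary.\<close>
  have neg: "AE a in lebesgue. a \<in> ?U \<longrightarrow> Jreal M hx (?gs i) (?l i) a < 0" if "i \<le> k + 1" for i
    using AE_not_in[OF null_boundary[OF that]]
  proof eventually_elim
    case (elim a)
    show ?case
    proof
      assume "a \<in> ?U"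
      then have "a \<in> ?V"
        using interior_subset by blast
      then have "Jreal M hx (?gs i) (?l i) a \<le> 0" "a \<in> ?C"
        using that M_pos by (auto simp: Jreal_le_iff[OF compact_x] valid_set_def invariant_iff)
      moreover have "Jreal M hx (?gs i) (?l i) a \<noteq> 0"
        using elim \<open>a \<in> ?C\<close> ereal_Jreal[OF compact_x, of M "?gs i" "?l i" a]
        by (auto simp: zero_ereal_def)
      ultimately show "Jreal M hx (?gs i) (?l i) a < 0"
        by simp
    qed
  qed
  \<comment> \<open>There are k + 2 conditions, indexed from 0 to k + 1, and each may spoil strictly
    less than an equal share of the interior.\<close>
  define \<eta> where "\<eta> = measure lebesgue ?U / (k + 2)"
  have "0 < \<eta>"
    using mU by (simp add: \<eta>_def)
  have "\<exists>d0. \<forall>d\<ge>d0. measure lebesgue {a \<in> ?U. 0 < peval (p d i) a} < \<eta>" if "i \<le> k + 1" for i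
    using measure_optimal_positive_set[OF pos_measure solvable[OF that] U neg[OF that] \<open>0 < \<eta>\<close>]
      optimal[OF that] by meson
  then obtain d0 where d0: "\<And>i d. i \<le> k + 1 \<Longrightarrow> d0 i \<le> d \<Longrightarrow>
      measure lebesgue {a \<in> ?U. 0 < peval (p d i) a} < \<eta>"
    by metis
  \<comment> \<open>Each threshold is valid for all larger degrees, so their maximum serves all
    conditions together.\<close>
  define d where "d = Max (d0 ` {..k + 1})"
  let ?B = "\<lambda>i. {a \<in> ?U. 0 < peval (p d i) a}"
  have "?U \<noteq> (\<Union>i\<le>k + 1. ?B i)"
  proof
    assume "?U = (\<Union>i\<le>k + 1. ?B i)"
    then have "measure lebesgue ?U = measure lebesgue (\<Union>i\<le>k + 1. ?B i)"
      by (rule arg_cong)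
    moreover have "measure lebesgue (\<Union>i\<le>k + 1. ?B i) \<le> (\<Sum>i\<le>k + 1. measure lebesgue (?B i))"
    proof (rule measure_UNION_le)
      show "?B i \<in> sets lebesgue" for i
      proof -
        have "open {a. 0 < peval (p d i) a}"
          by (intro open_Collect_less continuous_on_const continuous_on_peval)
        then show ?thesis
          unfolding Collect_conj_eq by (simp add: open_Int)
      qed
    qed simp
    moreover have "(\<Sum>i\<le>k + 1. measure lebesgue (?B i)) < (\<Sum>i\<le>k + 1. \<eta>)"
      by (intro sum_strict_mono d0) (auto simp: d_def)
    moreover have "(\<Sum>i\<le>k + 1. \<eta>) = measure lebesgue ?U"
      by (simp add: \<eta>_def field_simps)
    ultimately show False
      by linarith
  qed
  then obtain a where "a \<in> ?U" "a \<notin> (\<Union>i\<le>k + 1. ?B i)"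
    by blast
  then have "a \<in> ?U" "\<And>i. i \<le> k + 1 \<Longrightarrow> peval (p d i) a \<le> 0"
    by (auto simp: not_less)
  then have "a \<in> approx_param_set k ha (p d)"
    using U(1) by (auto simp: approx_param_set_def)
  \<comment> \<open>Nothing about the size of \<open>d\<close> enters here: feasibility alone puts
    the target below \<open>p d i\<close>.\<close>
  moreover have "approx_param_set k ha (p d) \<subseteq> ?V"
  proof
    fix a assume "a \<in> approx_param_set k ha (p d)"
    then have a: "a \<in> ?C" "\<And>i. i \<le> k + 1 \<Longrightarrow> peval (p d i) a \<le> 0"
      by (auto simp: approx_param_set_def)
    have "peval2 (?l i) a x \<le> 0" if "i \<le> k + 1" "x \<in> Kset hx (?gs i) a" for i x
    proof -
      have "sos_feasible d M ha hx (?gs i) (?l i) (p d i)"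
        using optimal[OF that(1)] by (simp add: sos_optimal_def)
      from sos_feasible_bounds(1)[OF this a(1) that(2)] show ?thesis
        using a(2)[OF that(1)] by linarith
    qed
    then show "a \<in> ?V"
      using a(1) by (simp add: valid_set_def invariant_iff)
  qed
  ultimately show ?thesis
    by (auto simp: valid_set_def)
qed

end
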